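(* Let $H$ be a $k$-local Hamiltonian on a $D$-dimensional cubic lattice $\Lambda$ with $N$ sites, let $\delta>0$, let $U$ be drawn from $\mathcal E(\delta)$, and put $H'=UHU^\dagger$. Then $$\|H-H'\|_\infty\le\delta .$$ Moreover, if (along a family of such systems with $N\to\infty$) $\delta=\Theta\big(N^{\frac{1-\alpha}{D+1}-\kappa}\big)$ with constants $\alpha\in[0,1)$ and $\kappa\ge0$, then for every state $\rho$ and every time $t\ge0$, $$\big\|e^{-iHt}\rho\,e^{iHt}-e^{-iH't}\rho\,e^{iH't}\big\|_1\le 2t\;O\!\left(N^{\frac{1-\alpha}{D+1}-\kappa}\right).$$
   Context: Setting: $\Lambda$ is a cubic $D$-dimensional lattice with $N$ sites; each site carries a Hilbert space of dimension $d$; $d,D,k$ are independent of $N$. A $k$-local Hamiltonian is $H=\sum_{i\in\Lambda}h_i$, where $h_i$ is Hermitian with operator norm $1$ and supported only on sites $j$ at Manhattan distance at most $k$ from $i$. The spectrum of $H$ is assumed non-degenerate. Ensemble $\mathcal E(\delta)$: divide the energy spectrum of $H$ into consecutive energy intervals $I_1,\dots,I_K$ of equal width $\delta$; let $\mathcal W_k$ be the span of the eigenstates of $H$ with energy in $I_k$. $\mathcal E(\delta)$ consists of the unitaries $U=\bigoplus_kU_k$ with $U_k$ in the unitary group of $\mathcal W_k$ (drawn from its Haar measure). The claim is for every such $U$. $\|\cdot\|_\infty$ is the operator norm and $\|\cdot\|_1$ the trace norm. The constant implied by $O(\cdot)$ is independent of $N$, $t$, $\rho$ and $U$. *)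

theory Defs
  imports
    Complex_Main
    "HOL-Library.FuncSet"
    "HOL-Library.Disjoint_Sets"
    "HOL-Library.Landau_Symbols"
    "Jordan_Normal_Form.Schur_Decomposition"
    "Jordan_Normal_Form.VS_Connect"
begin

section \<open>Complex matrices\<close>

definition hermitian :: "complex mat \<Rightarrow> bool" where
  "hermitian A \<longleftrightarrow> square_mat A \<and> mat_adjoint A = A"

definition positive_semidefinite :: "complex mat \<Rightarrow> bool" where
  "positive_semidefinite A \<longleftrightarrow>
     hermitian A \<and> (\<forall>v \<in> carrier_vec (dim_row A). 0 \<le> Re ((A *\<^sub>v v) \<bullet>c v))"

definition vec_norm2 :: "complex vec \<Rightarrow> real" where
  "vec_norm2 v = sqrt (Re (v \<bullet>c v))"

definition op_norm :: "complex mat \<Rightarrow> real" where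
  "op_norm A = Sup {vec_norm2 (A *\<^sub>v v) | v. v \<in> carrier_vec (dim_col A) \<and> vec_norm2 v \<le> 1}"

definition mat_trace :: "complex mat \<Rightarrow> complex" where
  "mat_trace A = (\<Sum>i<dim_row A. A $$ (i, i))"

definition mat_abs :: "complex mat \<Rightarrow> complex mat" where
  "mat_abs A = (THE B. B \<in> carrier_mat (dim_col A) (dim_col A) \<and>
                       positive_semidefinite B \<and> B * B = mat_adjoint A * A)"

definition trace_norm :: "complex mat \<Rightarrow> real" where
  "trace_norm A = Re (mat_trace (mat_abs A))"

definition mat_exp :: "complex mat \<Rightarrow> complex mat" where
  "mat_exp A = mat (dim_row A) (dim_row A) (\<lambda>(a, b). \<Sum>m. (A ^\<^sub>m m) $$ (a, b) / fact m)"

definition conj_by :: "complex mat \<Rightarrow> complex mat \<Rightarrow> complex mat" where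
  "conj_by U A = U * A * mat_adjoint U"

definition density_operator :: "nat \<Rightarrow> complex mat \<Rightarrow> bool" where
  "density_operator n \<rho> \<longleftrightarrow>
     \<rho> \<in> carrier_mat n n \<and> positive_semidefinite \<rho> \<and> mat_trace \<rho> = 1"

definition evolve :: "complex mat \<Rightarrow> real \<Rightarrow> complex mat \<Rightarrow> complex mat" where
  "evolve H t \<rho> =
     mat_exp ((- (\<i> * complex_of_real t)) \<cdot>\<^sub>m H) * \<rho> * mat_exp ((\<i> * complex_of_real t) \<cdot>\<^sub>m H)"

section \<open>Local Hamiltonians on the cubic lattice\<close>

definition digit :: "nat \<Rightarrow> nat \<Rightarrow> nat \<Rightarrow> nat" where
  "digit b i m = (m div b ^ i) mod b"

text \<open>The lattice is the cube \<open>{0..<L}\<^sup>D\<close> with open boundary.  Its \<open>N = L ^ D\<close> sites are numbered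
  \<open>s < L ^ D\<close>, the coordinates of \<open>s\<close> being its \<open>D\<close> digits in base \<open>L\<close>.\<close>

definition manhattan :: "nat \<Rightarrow> nat \<Rightarrow> nat \<Rightarrow> nat \<Rightarrow> nat" where
  "manhattan D L s s' = (\<Sum>a<D. nat \<bar>int (digit L a s) - int (digit L a s')\<bar>)"

text \<open>The Hilbert space of \<open>N\<close> sites of dimension \<open>d\<close> is identified with \<open>d ^ N\<close>-dimensional complex
  space: the basis vector with index \<open>m < d ^ N\<close> is the product vector whose local state at site \<open>s\<close>
  is the digit of \<open>m\<close> at position \<open>s\<close> in base \<open>d\<close>.  An operator is supported on \<open>S\<close> if
  it is of the form \<open>A \<otimes> 1\<close>, with \<open>A\<close> acting on the factors in \<open>S\<close>; here \<open>A\<close> is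
  given by its matrix elements between local configurations.\<close>

definition supported_on :: "nat \<Rightarrow> nat \<Rightarrow> nat set \<Rightarrow> complex mat \<Rightarrow> bool" where
  "supported_on d N S B \<longleftrightarrow>
     (\<exists>A :: (nat \<Rightarrow> nat) \<Rightarrow> (nat \<Rightarrow> nat) \<Rightarrow> complex.
        \<forall>m < d ^ N. \<forall>m' < d ^ N.
          B $$ (m, m') =
            A (restrict (\<lambda>s. digit d s m) S) (restrict (\<lambda>s. digit d s m') S) *
            (if \<forall>s \<in> {..<N} - S. digit d s m = digit d s m' then 1 else 0))"

definition local_hamiltonian :: "nat \<Rightarrow> nat \<Rightarrow> nat \<Rightarrow> nat \<Rightarrow> complex mat \<Rightarrow> bool" where
  "local_hamiltonian d D k L H \<longleftrightarrow>
     (let N = L ^ D in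
      \<exists>h :: nat \<Rightarrow> complex mat.
        (\<forall>i<N. h i \<in> carrier_mat (d ^ N) (d ^ N) \<and> hermitian (h i) \<and> op_norm (h i) = 1 \<and>
               supported_on d N {j. j < N \<and> manhattan D L i j \<le> k} (h i)) \<and>
        H = mat (d ^ N) (d ^ N) (\<lambda>ab. \<Sum>i<N. h i $$ ab))"

definition nondegenerate :: "complex mat \<Rightarrow> bool" where
  "nondegenerate H \<longleftrightarrow>
     (\<forall>E v w. eigenvector H v E \<and> eigenvector H w E \<longrightarrow> (\<exists>c. w = c \<cdot>\<^sub>v v))"

section \<open>The ensemble of energy-conserving unitaries\<close>

text \<open>The common endpoints of neighbouring intervals may be assigned to either interval, and the
  division may start at any energy \<open>E0\<close>, as long as the whole spectrum is covered.\<close>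

definition energy_windows :: "complex mat \<Rightarrow> real \<Rightarrow> nat \<Rightarrow> (nat \<Rightarrow> real set) \<Rightarrow> bool" where
  "energy_windows H \<delta> K I \<longleftrightarrow>
     (\<exists>E0. \<forall>j<K. {E0 + real j * \<delta> <..< E0 + real (j + 1) * \<delta>} \<subseteq> I j \<and>
                  I j \<subseteq> {E0 + real j * \<delta> .. E0 + real (j + 1) * \<delta>}) \<and>
     disjoint_family_on I {..<K} \<and>
     (\<forall>E. eigenvalue H (complex_of_real E) \<longrightarrow> (\<exists>j<K. E \<in> I j))"

definition window_space :: "complex mat \<Rightarrow> real set \<Rightarrow> complex vec set" where
  "window_space H J =
     LinearCombinations.module.span class_ring (module_vec TYPE(complex) (dim_row H))
       {v. \<exists>E \<in> J. eigenvector H v (complex_of_real E)}"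

definition unitary_on :: "complex vec set \<Rightarrow> (complex vec \<Rightarrow> complex vec) \<Rightarrow> bool" where
  "unitary_on W u \<longleftrightarrow>
     bij_betw u W W \<and>
     (\<forall>v \<in> W. \<forall>w \<in> W. u (v + w) = u v + u w) \<and>
     (\<forall>c. \<forall>v \<in> W. u (c \<cdot>\<^sub>v v) = c \<cdot>\<^sub>v u v) \<and>
     (\<forall>v \<in> W. \<forall>w \<in> W. u v \<bullet>c u w = v \<bullet>c w)"

text \<open>The support of the random unitary: all \<open>U\<close> that act on each window space as a unitary of that
  space, i.e. all direct sums of such unitaries.\<close>

definition ensemble :: "complex mat \<Rightarrow> nat \<Rightarrow> (nat \<Rightarrow> real set) \<Rightarrow> complex mat set" where
  "ensemble H K I =
     {U \<in> carrier_mat (dim_row H) (dim_row H).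
        \<exists>u. \<forall>j<K. unitary_on (window_space H (I j)) (u j) \<and>
                   (\<forall>w \<in> window_space H (I j). U *\<^sub>v w = u j w)}"

end

theory Submission
  imports Defs "HOL-Analysis.L2_Norm" "Jordan_Normal_Form.Spectral_Radius"
begin

text \<open>Replacing every energy by the centre of its window gives an operator \<open>C\<close> that commutes with \<open>U\<close>
  and satisfies \<open>\<parallel>H - C\<parallel> \<le> \<delta> / 2\<close>; hence \<open>H - H' = (H - C) - U (H - C) U\<^sup>\<dagger>\<close> has norm at most \<open>\<delta>\<close>.
  Duhamel's formula turns this into \<open>\<parallel>e\<^sup>-\<^sup>i\<^sup>t\<^sup>H a - e\<^sup>-\<^sup>i\<^sup>t\<^sup>H\<^sup>' a\<parallel> \<le> t \<delta> \<parallel>a\<parallel>\<close>, and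
  diagonalising both the state and the difference of the evolved states bounds the trace norm of the latter by
  \<open>2 t \<delta>\<close>.\<close>

section \<open>Adjoints and unitary matrices\<close>

text \<open>Membership in \<open>ensemble\<close> only prescribes how U acts on each window space,
  so unitarity of the whole matrix U has to be derived, and \<open>C\<close> serves for this as
  well. It is a scalar on each window space, and because \<delta> > 0 the centres of different
  windows differ, so images of eigenvectors from different windows are orthogonal. Taking centres
  rather than endpoints makes each of the two copies of H - C contribute only half of \<delta>. The
  trace norm rests on a definite description of |A|, so it can be evaluated only once positive
  semidefinite square roots are known to be unique. Hence the spectral theorem is proved early and
  Hermitian matrices are handled in the form \<open>spectral_mat n V f\<close>, in which powers,
  exponentials and moduli become scalar operations on \<open>f\<close>. The factor 2 in the trace
  norm bound is the sum of the norms of two unit vectors, coming from a difference of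
  squares.\<close>

lemma mat_adjoint_dim [simp]:
  "dim_row (mat_adjoint A) = dim_col A" "dim_col (mat_adjoint A) = dim_row A"
  by (auto simp: mat_adjoint_def)

lemma mat_adjoint_carrier [simp]: "A \<in> carrier_mat m n \<Longrightarrow> mat_adjoint A \<in> carrier_mat n m"
  by (auto intro!: carrier_matI)

lemma mat_adjoint_index [simp]:
  fixes A :: "complex mat"
  shows "i < dim_col A \<Longrightarrow> j < dim_row A \<Longrightarrow> mat_adjoint A $$ (i, j) = cnj (A $$ (j, i))"
  by (auto simp: mat_adjoint_def mat_of_rows_def)

lemma mat_adjoint_adjoint [simp]:
  fixes A :: "complex mat"
  shows "mat_adjoint (mat_adjoint A) = A"
  by (rule eq_matI) auto

lemma mat_mult_index:
  assumes "A \<in> carrier_mat l m" "B \<in> carrier_mat m n" "i < l" "j < n"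
  shows "(A * B) $$ (i, j) = (\<Sum>k<m. A $$ (i, k) * B $$ (k, j))"
  using assms by (auto simp: scalar_prod_def lessThan_atLeast0 intro!: sum.cong)

lemma mat_vec_index:
  assumes "A \<in> carrier_mat l m" "v \<in> carrier_vec m" "i < l"
  shows "(A *\<^sub>v v) $ i = (\<Sum>k<m. A $$ (i, k) * v $ k)"
  using assms by (auto simp: scalar_prod_def lessThan_atLeast0 intro!: sum.cong)

lemma mat_adjoint_mult:
  fixes A B :: "complex mat"
  assumes "A \<in> carrier_mat l m" "B \<in> carrier_mat m n"
  shows "mat_adjoint (A * B) = mat_adjoint B * mat_adjoint A"
proof (rule eq_matI)
  fix i j assume "i < dim_row (mat_adjoint B * mat_adjoint A)" "j < dim_col (mat_adjoint B * mat_adjoint A)"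
  then have ij: "i < n" "j < l" using assms by auto
  have "mat_adjoint (A * B) $$ (i, j) = cnj ((A * B) $$ (j, i))"
    using assms ij by (subst mat_adjoint_index) auto
  also have "\<dots> = (\<Sum>k<m. mat_adjoint B $$ (i, k) * mat_adjoint A $$ (k, j))"
    using assms ij by (simp add: mat_mult_index[OF assms] mult.commute del: index_mult_mat)
  also have "\<dots> = (mat_adjoint B * mat_adjoint A) $$ (i, j)"
    using assms ij by (simp add: mat_mult_index[of _ n m _ l] del: index_mult_mat)
  finally show "mat_adjoint (A * B) $$ (i, j) = (mat_adjoint B * mat_adjoint A) $$ (i, j)" .
qed (use assms in auto)

lemma mat_adjoint_minus:
  fixes A B :: "complex mat"
  assumes "A \<in> carrier_mat m n" "B \<in> carrier_mat m n"
  shows "mat_adjoint (A - B) = mat_adjoint A - mat_adjoint B"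
  using assms by (intro eq_matI) auto

lemma hermitianI:
  assumes "A \<in> carrier_mat n n" "mat_adjoint A = A"
  shows "hermitian A"
  using assms by (auto simp: hermitian_def)

lemma hermitian_adjoint: "hermitian A \<Longrightarrow> mat_adjoint A = A"
  by (simp add: hermitian_def)

definition unitary_mat :: "nat \<Rightarrow> complex mat \<Rightarrow> bool" where
  "unitary_mat n U \<longleftrightarrow>
     U \<in> carrier_mat n n \<and> mat_adjoint U * U = 1\<^sub>m n \<and> U * mat_adjoint U = 1\<^sub>m n"

text \<open>For square matrices a left inverse is also a right inverse, so orthonormality of the
  columns suffices.\<close>

lemma unitary_matI:
  assumes "U \<in> carrier_mat n n" "mat_adjoint U * U = 1\<^sub>m n"
  shows "unitary_mat n U"
  using assms mat_mult_left_right_inverse[of "mat_adjoint U" n U] by (auto simp: unitary_mat_def)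

lemma unitary_mat_carrier: "unitary_mat n U \<Longrightarrow> U \<in> carrier_mat n n"
  by (simp add: unitary_mat_def)

lemma unitary_mat_adjoint: "unitary_mat n U \<Longrightarrow> unitary_mat n (mat_adjoint U)"
  by (auto simp: unitary_mat_def)

lemma unitary_mat_mult:
  assumes U: "unitary_mat n U" and V: "unitary_mat n V"
  shows "unitary_mat n (U * V)"
proof (rule unitary_matI)
  note c = unitary_mat_carrier[OF U] unitary_mat_carrier[OF V]
  show "U * V \<in> carrier_mat n n" using c by simp
  have "mat_adjoint (U * V) * (U * V) = mat_adjoint V * (mat_adjoint U * (U * V))"
    using c by (simp add: mat_adjoint_mult[OF c] assoc_mult_mat[of _ n n _ n _ n])
  also have "mat_adjoint U * (U * V) = (mat_adjoint U * U) * V"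
    using c by (intro assoc_mult_mat[symmetric]) auto
  also have "\<dots> = V" using U c by (simp add: unitary_mat_def)
  finally show "mat_adjoint (U * V) * (U * V) = 1\<^sub>m n" using V by (simp add: unitary_mat_def)
qed

section \<open>Euclidean norm\<close>

lemma cscalar_prod_sum:
  fixes v w :: "complex vec"
  assumes "v \<in> carrier_vec n" "w \<in> carrier_vec n"
  shows "v \<bullet>c w = (\<Sum>i<n. v $ i * cnj (w $ i))"
  using assms by (auto simp: scalar_prod_def lessThan_atLeast0 intro!: sum.cong)

text \<open>The bridge through which the triangle and Cauchy-Schwarz inequalities for
  \<open>L2_set\<close> are transferred to complex vectors.\<close>

lemma vec_norm2_L2_set:
  assumes "v \<in> carrier_vec n"
  shows "vec_norm2 v = L2_set (\<lambda>i. cmod (v $ i)) {..<n}"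
proof -
  have "Re (v \<bullet>c v) = (\<Sum>i<n. (cmod (v $ i))\<^sup>2)"
    unfolding cscalar_prod_sum[OF assms assms]
    by (simp add: complex_mult_cnj cmod_def power2_eq_square)
  then show ?thesis by (simp add: vec_norm2_def L2_set_def)
qed

lemma vec_norm2_nonneg: "vec_norm2 v \<ge> 0"
  using vec_norm2_L2_set[OF carrier_vec_dim_vec, of v] by simp

lemma vec_norm2_square:
  assumes "v \<in> carrier_vec n"
  shows "complex_of_real ((vec_norm2 v)\<^sup>2) = v \<bullet>c v"
proof -
  have "(vec_norm2 v)\<^sup>2 = (\<Sum>i<n. (cmod (v $ i))\<^sup>2)"
    unfolding vec_norm2_L2_set[OF assms] by (simp add: L2_set_def sum_nonneg)
  then show ?thesis unfolding cscalar_prod_sum[OF assms assms]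
    by (simp add: complex_norm_square[symmetric])
qed

lemma vec_norm2_minus_le:
  assumes "v \<in> carrier_vec n" "w \<in> carrier_vec n"
  shows "vec_norm2 (v - w) \<le> vec_norm2 v + vec_norm2 w"
proof -
  have "L2_set (\<lambda>i. cmod ((v - w) $ i)) {..<n} \<le> L2_set (\<lambda>i. cmod (v $ i) + cmod (w $ i)) {..<n}"
    using assms by (intro L2_set_mono) (auto simp: norm_triangle_ineq4)
  also have "\<dots> \<le> L2_set (\<lambda>i. cmod (v $ i)) {..<n} + L2_set (\<lambda>i. cmod (w $ i)) {..<n}"
    by (rule L2_set_triangle_ineq)
  finally show ?thesis using assms by (simp add: vec_norm2_L2_set[of _ n])
qed

lemma cscalar_prod_Cauchy_Schwarz:
  assumes "v \<in> carrier_vec n" "w \<in> carrier_vec n"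
  shows "cmod (v \<bullet>c w) \<le> vec_norm2 v * vec_norm2 w"
proof -
  have "cmod (v \<bullet>c w) \<le> (\<Sum>i<n. \<bar>cmod (v $ i)\<bar> * \<bar>cmod (w $ i)\<bar>)"
    unfolding cscalar_prod_sum[OF assms] by (rule order_trans[OF norm_sum]) (simp add: norm_mult)
  also have "\<dots> \<le> vec_norm2 v * vec_norm2 w"
    using L2_set_mult_ineq[of "\<lambda>i. cmod (v $ i)" "\<lambda>i. cmod (w $ i)" "{..<n}"] assms
    by (simp add: vec_norm2_L2_set[of _ n])
  finally show ?thesis .
qed

lemma cscalar_prod_adjoint:
  fixes A :: "complex mat"
  assumes "A \<in> carrier_mat m n" "v \<in> carrier_vec n" "w \<in> carrier_vec m"
  shows "(A *\<^sub>v v) \<bullet>c w = v \<bullet>c (mat_adjoint A *\<^sub>v w)"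
proof -
  have "(A *\<^sub>v v) \<bullet>c w = (\<Sum>i<m. \<Sum>k<n. A $$ (i, k) * v $ k * cnj (w $ i))"
    using assms by (subst cscalar_prod_sum[of _ m])
      (auto simp: mat_vec_index[of _ m n] sum_distrib_right simp del: index_mult_mat_vec)
  also have "\<dots> = (\<Sum>k<n. \<Sum>i<m. A $$ (i, k) * v $ k * cnj (w $ i))"
    by (rule sum.swap)
  also have "\<dots> = (\<Sum>k<n. v $ k * cnj ((mat_adjoint A *\<^sub>v w) $ k))"
  proof (rule sum.cong[OF refl])
    fix k assume "k \<in> {..<n}"
    then show "(\<Sum>i<m. A $$ (i, k) * v $ k * cnj (w $ i)) = v $ k * cnj ((mat_adjoint A *\<^sub>v w) $ k)"
      using assms by (subst mat_vec_index[of _ n m]) (auto simp: sum_distrib_left mult_ac)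
  qed
  also have "\<dots> = v \<bullet>c (mat_adjoint A *\<^sub>v w)"
    using assms by (subst cscalar_prod_sum[of _ n]) (auto simp: mult_mat_vec_carrier[of _ n m])
  finally show ?thesis .
qed

lemma cscalar_prod_unitary:
  assumes "unitary_mat n U" "v \<in> carrier_vec n" "w \<in> carrier_vec n"
  shows "(U *\<^sub>v v) \<bullet>c (U *\<^sub>v w) = v \<bullet>c w"
proof -
  note c = unitary_mat_carrier[OF assms(1)]
  have "mat_adjoint U *\<^sub>v (U *\<^sub>v w) = w"
    using assms c by (subst assoc_mult_mat_vec[symmetric, of _ n n _ n]) (auto simp: unitary_mat_def)
  then show ?thesis using assms c by (subst cscalar_prod_adjoint[of _ n n]) auto
qed

lemma vec_norm2_unitary:
  assumes "unitary_mat n U" "v \<in> carrier_vec n"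
  shows "vec_norm2 (U *\<^sub>v v) = vec_norm2 v"
  by (simp add: vec_norm2_def cscalar_prod_unitary[OF assms assms(2)])

section \<open>Functional calculus\<close>

text \<open>The operator with eigenvalue \<open>f k\<close> on column k of \<open>V\<close>.
  Indexing \<open>f\<close> by the column instead of by an eigenvalue allows several operators, such
  as H and its coarse-grained version, to share one eigenbasis. Only the values of \<open>f\<close>
  below n enter.\<close>

definition spectral_mat :: "nat \<Rightarrow> complex mat \<Rightarrow> (nat \<Rightarrow> complex) \<Rightarrow> complex mat" where
  "spectral_mat n V f = V * mat_diag n f * mat_adjoint V"

lemma spectral_mat_dim [simp]:
  "dim_row (spectral_mat n V f) = dim_row V" "dim_col (spectral_mat n V f) = dim_row V"
  by (simp_all add: spectral_mat_def)

lemma spectral_mat_carrier [simp]: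
  "V \<in> carrier_mat n n \<Longrightarrow> spectral_mat n V f \<in> carrier_mat n n"
  by (auto intro!: carrier_matI)

lemma spectral_mat_index:
  assumes "V \<in> carrier_mat n n" "i < n" "j < n"
  shows "spectral_mat n V f $$ (i, j) = (\<Sum>k<n. V $$ (i, k) * f k * cnj (V $$ (j, k)))"
  unfolding spectral_mat_def using assms
  by (subst mat_mult_index[of _ n n _ n]) (auto simp: mat_diag_mult_right)

lemma adjoint_spectral_mat:
  assumes "V \<in> carrier_mat n n"
  shows "mat_adjoint (spectral_mat n V f) = spectral_mat n V (\<lambda>k. cnj (f k))"
  using assms
  by (intro eq_matI) (auto simp: spectral_mat_index mult_ac)

lemma hermitian_spectral_mat:
  assumes "V \<in> carrier_mat n n" "\<And>k. f k \<in> \<real>"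
  shows "hermitian (spectral_mat n V f)"
proof (rule hermitianI)
  have "(\<lambda>k. cnj (f k)) = f" using assms(2) by (auto simp: Reals_cnj_iff)
  then show "mat_adjoint (spectral_mat n V f) = spectral_mat n V f"
    by (simp add: adjoint_spectral_mat[OF assms(1)])
qed (rule spectral_mat_carrier[OF assms(1)])

lemma spectral_mat_minus:
  assumes "V \<in> carrier_mat n n"
  shows "spectral_mat n V f - spectral_mat n V g = spectral_mat n V (\<lambda>k. f k - g k)"
  using assms
  by (intro eq_matI) (auto simp: spectral_mat_index sum_subtractf algebra_simps)

lemma smult_spectral_mat:
  assumes "V \<in> carrier_mat n n"
  shows "c \<cdot>\<^sub>m spectral_mat n V f = spectral_mat n V (\<lambda>k. c * f k)"
  using assms
  by (intro eq_matI) (auto simp: spectral_mat_index sum_distrib_left mult_ac)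

lemma spectral_mat_mult:
  assumes "unitary_mat n V"
  shows "spectral_mat n V f * spectral_mat n V g = spectral_mat n V (\<lambda>k. f k * g k)"
proof -
  note c = unitary_mat_carrier[OF assms]
  note a = assoc_mult_mat[of _ n n _ n _ n]
  have "spectral_mat n V f * spectral_mat n V g
      = V * (mat_diag n f * ((mat_adjoint V * V) * (mat_diag n g * mat_adjoint V)))"
    using c by (simp add: spectral_mat_def a mult_carrier_mat[of _ n n _ n])
  also have "mat_adjoint V * V = 1\<^sub>m n" using assms by (simp add: unitary_mat_def)
  also have "1\<^sub>m n * (mat_diag n g * mat_adjoint V) = mat_diag n g * mat_adjoint V"
    using c by (intro left_mult_one_mat[of _ n n] mult_carrier_mat[of _ n n _ n]) auto
  also have "mat_diag n f * (mat_diag n g * mat_adjoint V) = mat_diag n (\<lambda>k. f k * g k) * mat_adjoint V"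
    using c by (subst assoc_mult_mat[of _ n n _ n _ n, symmetric]) auto
  finally show ?thesis using c by (simp add: spectral_mat_def a mult_carrier_mat[of _ n n _ n])
qed

lemma spectral_mat_one:
  assumes "unitary_mat n V"
  shows "spectral_mat n V (\<lambda>k. 1) = 1\<^sub>m n"
  using assms by (auto simp: spectral_mat_def unitary_mat_def)

lemma spectral_mat_pow:
  assumes "unitary_mat n V"
  shows "spectral_mat n V f ^\<^sub>m m = spectral_mat n V (\<lambda>k. f k ^ m)"
proof (induct m)
  case 0
  then show ?case
    using spectral_mat_one[OF assms] unitary_mat_carrier[OF assms] by auto
next
  case (Suc m)
  then show ?case by (simp add: spectral_mat_mult[OF assms] mult.commute)
qed

lemma unitary_spectral_mat:
  assumes "unitary_mat n V" "\<And>k. cmod (f k) = 1"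
  shows "unitary_mat n (spectral_mat n V f)"
proof (rule unitary_matI)
  have "(\<lambda>k. cnj (f k) * f k) = (\<lambda>k. 1)"
  proof
    fix k
    show "cnj (f k) * f k = 1"
      using complex_norm_square[of "f k"] assms(2)[of k] by (simp add: mult.commute)
  qed
  then show "mat_adjoint (spectral_mat n V f) * spectral_mat n V f = 1\<^sub>m n"
    using assms(1)
    by (simp add: adjoint_spectral_mat unitary_mat_carrier spectral_mat_mult spectral_mat_one)
qed (use assms in \<open>simp add: spectral_mat_carrier unitary_mat_carrier\<close>)

lemma mat_trace_spectral_mat:
  assumes "unitary_mat n V"
  shows "mat_trace (spectral_mat n V f) = (\<Sum>k<n. f k)"
proof -
  note c = unitary_mat_carrier[OF assms]
  have "mat_trace (spectral_mat n V f) = (\<Sum>i<n. \<Sum>k<n. V $$ (i, k) * f k * cnj (V $$ (i, k)))"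
    using c by (auto simp: mat_trace_def spectral_mat_index[OF c] intro!: sum.cong)
  also have "\<dots> = (\<Sum>k<n. \<Sum>i<n. V $$ (i, k) * f k * cnj (V $$ (i, k)))"
    by (rule sum.swap)
  also have "\<dots> = (\<Sum>k<n. f k * (mat_adjoint V * V) $$ (k, k))"
    using c by (intro sum.cong refl)
      (simp add: mat_mult_index[of _ n n _ n] sum_distrib_left mult_ac del: index_mult_mat)
  also have "\<dots> = (\<Sum>k<n. f k)"
    using assms by (auto simp: unitary_mat_def)
  finally show ?thesis .
qed

text \<open>\<open>V\<close> and its adjoint preserve the norm, so only the diagonal factor matters,
  and it multiplies coordinate i by \<open>f i\<close>.\<close>

lemma vec_norm2_spectral_mat_le:
  assumes V: "unitary_mat n V" and v: "v \<in> carrier_vec n"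
    and f: "\<And>k. k < n \<Longrightarrow> cmod (f k) \<le> c" and c: "0 \<le> c"
  shows "vec_norm2 (spectral_mat n V f *\<^sub>v v) \<le> c * vec_norm2 v"
proof -
  note cV = unitary_mat_carrier[OF V]
  define w where "w = mat_adjoint V *\<^sub>v v"
  have w: "w \<in> carrier_vec n" using cV v by (auto simp: w_def intro: mult_mat_vec_carrier[of _ n n])
  have "spectral_mat n V f *\<^sub>v v = V *\<^sub>v (mat_diag n f *\<^sub>v w)"
    using cV v by (simp add: spectral_mat_def w_def assoc_mult_mat_vec[of _ n n _ n]
        mult_mat_vec_carrier[of _ n n] mult_carrier_mat[of _ n n _ n])
  then have "vec_norm2 (spectral_mat n V f *\<^sub>v v) = vec_norm2 (mat_diag n f *\<^sub>v w)"
    using V w by (simp add: vec_norm2_unitary mult_mat_vec_carrier[of _ n n])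
  also have "mat_diag n f *\<^sub>v w = vec n (\<lambda>i. f i * w $ i)"
  proof (rule eq_vecI)
    fix i assume "i < dim_vec (vec n (\<lambda>i. f i * w $ i))"
    then have i: "i < n" by simp
    have "(mat_diag n f *\<^sub>v w) $ i = (\<Sum>k<n. mat_diag n f $$ (i, k) * w $ k)"
      using w i by (intro mat_vec_index) auto
    also have "\<dots> = (\<Sum>k<n. if k = i then f k * w $ k else 0)"
      using i by (intro sum.cong) (auto simp: mat_diag_def)
    finally show "(mat_diag n f *\<^sub>v w) $ i = vec n (\<lambda>i. f i * w $ i) $ i" using i by simp
  qed (simp add: mat_diag_def)
  also have "vec_norm2 \<dots> \<le> L2_set (\<lambda>i. c * cmod (w $ i)) {..<n}"
    by (subst vec_norm2_L2_set[of _ n]) (auto intro!: L2_set_mono mult_right_mono simp: norm_mult f)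
  also have "\<dots> = c * vec_norm2 w"
    using w c by (simp add: vec_norm2_L2_set[of _ n] L2_set_right_distrib)
  also have "vec_norm2 w = vec_norm2 v"
    unfolding w_def using unitary_mat_adjoint[OF V] v by (rule vec_norm2_unitary)
  finally show ?thesis .
qed

section \<open>Spectral theorem\<close>

text \<open>Gram-Schmidt leaves the first vector of a list unchanged, so completing v to a basis,
  orthogonalising and normalising keeps v, up to a scalar, in column 0. This prepares the deflation
  step of the spectral theorem.\<close>

lemma unitary_with_first_column:
  fixes v :: "complex vec"
  assumes v: "v \<in> carrier_vec n" "v \<noteq> 0\<^sub>v n"
  shows "\<exists>W c. unitary_mat n W \<and> col W 0 = c \<cdot>\<^sub>v v"
proof -
  interpret cof_vec_space n "TYPE(complex)" .
  define b where "b = basis_completion v"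
  define ws where "ws = gram_schmidt n b"
  note bc = basis_completion[OF v, folded b_def]
  note gs = gram_schmidt_result[OF bc(2,4,5) refl, folded ws_def]
  have len: "length ws = n" using gs(4) bc(6) by simp
  have n: "n > 0" using v by (metis carrier_vecD eq_vecI index_zero_vec(2) neq0_conv not_less_zero)
  have "b = v # tl b" using bc(6,7) n by (cases b) auto
  then have hd: "hd ws = v" unfolding ws_def using v(1) by (metis gram_schmidt_hd)
  have ws: "ws ! j \<in> carrier_vec n" if "j < n" for j using gs(3) len that by auto
  have nz: "vec_norm2 (ws ! j) \<noteq> 0" if "j < n" for j
    using corthogonalD[OF gs(2), of j j] len that vec_norm2_square[OF ws[OF that]] by auto
  \<comment> \<open>The vectors \<open>ws\<close> are orthogonal but not yet of unit length, hence
    the division by their norms.\<close>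
  define W where "W = mat n n (\<lambda>(i, j). ws ! j $ i / vec_norm2 (ws ! j))"
  have W: "W \<in> carrier_mat n n" by (simp add: W_def)
  have "unitary_mat n W"
  proof (rule unitary_matI[OF W], rule eq_matI)
    fix i j assume "i < dim_row (1\<^sub>m n)" "j < dim_col (1\<^sub>m n)"
    then have ij: "i < n" "j < n" by auto
    have "(mat_adjoint W * W) $$ (i, j)
        = (\<Sum>k<n. ws ! j $ k * cnj (ws ! i $ k)) / (vec_norm2 (ws ! i) * vec_norm2 (ws ! j))"
      using ij W by (simp add: mat_mult_index[of _ n n _ n] W_def sum_divide_distrib mult.commute
          del: index_mult_mat)
    also have "(\<Sum>k<n. ws ! j $ k * cnj (ws ! i $ k)) = ws ! j \<bullet>c ws ! i"
      using ij ws by (simp add: cscalar_prod_sum[of _ n])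
    also have "\<dots> / (vec_norm2 (ws ! i) * vec_norm2 (ws ! j)) = (if i = j then 1 else 0)"
    proof (cases "i = j")
      case True
      then have "ws ! j \<bullet>c ws ! i = complex_of_real ((vec_norm2 (ws ! i))\<^sup>2)"
        using vec_norm2_square[OF ws[OF ij(1)]] by simp
      then show ?thesis using nz[OF ij(1)] True by (simp add: power2_eq_square)
    next
      case False
      then show ?thesis using corthogonalD[OF gs(2), of j i] len ij by auto
    qed
    finally show "(mat_adjoint W * W) $$ (i, j) = 1\<^sub>m n $$ (i, j)" using ij by simp
  qed (use W in auto)
  moreover have "ws ! 0 = v" using hd len n hd_conv_nth[of ws] by fastforce
  then have "col W 0 = (1 / vec_norm2 v) \<cdot>\<^sub>v v"
    using n v by (intro eq_vecI) (auto simp: W_def)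
  ultimately show ?thesis by blast
qed

text \<open>A change of basis touches only the eigenbasis and leaves the eigenvalues alone.\<close>

lemma conj_spectral_mat:
  assumes "W \<in> carrier_mat n n" "V \<in> carrier_mat n n"
  shows "W * spectral_mat n V f * mat_adjoint W = spectral_mat n (W * V) f"
  using assms unfolding spectral_mat_def
  by (simp add: mat_adjoint_mult[OF assms] assoc_mult_mat[of _ n n _ n _ n] mult_carrier_mat[of _ n n _ n])

text \<open>Induction on the dimension by deflation: in an orthonormal basis that starts with an
  eigenvector, a Hermitian matrix splits into a 1 by 1 block and a Hermitian block of size n, to
  which the induction hypothesis applies.\<close>

theorem hermitian_spectral:
  assumes "A \<in> carrier_mat n n" "hermitian A"
  shows "\<exists>V d. unitary_mat n V \<and> A = spectral_mat n V (\<lambda>k. complex_of_real (d k))"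
  using assms
proof (induct n arbitrary: A)
  case 0
  have "unitary_mat 0 (1\<^sub>m 0)" by (rule unitary_matI) auto
  moreover have "A = spectral_mat 0 (1\<^sub>m 0) (\<lambda>k. complex_of_real 0)" using 0 by (intro eq_matI) auto
  ultimately show ?case by (intro exI[of _ "1\<^sub>m 0"] exI[of _ "\<lambda>_. 0"]) auto
next
  case (Suc n)
  let ?n = "Suc n"
  note A = Suc.prems(1)
  obtain e where "eigenvalue A e"
    using spectrum_non_empty[OF A] by (auto simp: spectrum_def)
  then obtain v where v: "v \<in> carrier_vec ?n" "v \<noteq> 0\<^sub>v ?n" "A *\<^sub>v v = e \<cdot>\<^sub>v v"
    using A by (auto simp: eigenvalue_def eigenvector_def)
  obtain W c where W: "unitary_mat ?n W" and col: "col W 0 = c \<cdot>\<^sub>v v"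
    using unitary_with_first_column[OF v(1,2)] by blast
  note cW = unitary_mat_carrier[OF W]
  note [simp] = mult_carrier_mat[of _ ?n ?n _ ?n]
  define M where "M = mat_adjoint W * A * W"
  have M: "M \<in> carrier_mat ?n ?n" using A cW by (simp add: M_def)
  have herm: "mat_adjoint M = M"
    using A cW hermitian_adjoint[OF Suc.prems(2)]
    by (simp add: M_def mat_adjoint_mult[of _ ?n ?n _ ?n] assoc_mult_mat[of _ ?n ?n _ ?n _ ?n])
  have Msym: "M $$ (i, j) = cnj (M $$ (j, i))" if "i < ?n" "j < ?n" for i j
    using mat_adjoint_index[of i M j] that M herm by simp
  have "A *\<^sub>v col W 0 = e \<cdot>\<^sub>v col W 0"
    using A v by (simp add: col mult_mat_vec[of _ ?n ?n] smult_smult_assoc mult.commute)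
  have "M = mat_adjoint W * (A * W)"
    using A cW by (simp add: M_def assoc_mult_mat[of _ ?n ?n _ ?n _ ?n])
  then have "col M 0 = mat_adjoint W *\<^sub>v col (A * W) 0"
    using A cW by (simp only:) (intro col_mult2[of _ ?n ?n _ ?n], auto)
  also have "col (A * W) 0 = A *\<^sub>v col W 0"
    using A cW by (intro col_mult2[of _ ?n ?n _ ?n]) auto
  also have "A *\<^sub>v col W 0 = e \<cdot>\<^sub>v col W 0" by fact
  also have "mat_adjoint W *\<^sub>v (e \<cdot>\<^sub>v col W 0) = e \<cdot>\<^sub>v (mat_adjoint W *\<^sub>v col W 0)"
    using cW by (intro mult_mat_vec[of _ ?n ?n] col_carrier_vec) auto
  also have "mat_adjoint W *\<^sub>v col W 0 = col (mat_adjoint W * W) 0"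
    using cW by (intro col_mult2[of _ ?n ?n _ ?n, symmetric]) auto
  also have "mat_adjoint W * W = 1\<^sub>m ?n" using W by (simp add: unitary_mat_def)
  finally have colM: "col M 0 = e \<cdot>\<^sub>v col (1\<^sub>m ?n) 0" .
  have M0: "M $$ (i, 0) = (if i = 0 then e else 0)" if "i < ?n" for i
    using arg_cong[OF colM, of "\<lambda>v. v $ i"] that M by auto
  \<comment> \<open>The eigenvector gives column 0; Hermitian symmetry turns this into the vanishing
    of the rest of row 0.\<close>
  have M0': "M $$ (0, i) = (if i = 0 then e else 0)" if "i < ?n" for i
    using M0[OF that] M0[of 0] Msym[OF _ that, of 0] by (cases "i = 0") simp_all
  have "M $$ (0, 0) = e" using M0[of 0] by simp
  \<comment> \<open>The eigenvalue is a diagonal entry of a Hermitian matrix, hence real.\<close>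
  then have "cnj e = e" using Msym[of 0 0, OF zero_less_Suc zero_less_Suc] by metis
  then obtain r where e: "e = complex_of_real r" by (metis Reals_cnj_iff Reals_cases)
  define A' where "A' = mat n n (\<lambda>(i, j). M $$ (Suc i, Suc j))"
  have A': "A' \<in> carrier_mat n n" by (simp add: A'_def)
  have "hermitian A'"
  proof (rule hermitianI[OF A'], rule eq_matI)
    fix i j assume "i < dim_row A'" "j < dim_col A'"
    then show "mat_adjoint A' $$ (i, j) = A' $$ (i, j)"
      using Msym[of "Suc i" "Suc j"] by (simp add: A'_def)
  qed (auto simp: A'_def)
  then obtain V' d' where V': "unitary_mat n V'"
    and A'_eq: "A' = spectral_mat n V' (\<lambda>k. complex_of_real (d' k))"
    using Suc.hyps[OF A'] by blast
  note cV' = unitary_mat_carrier[OF V']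
  \<comment> \<open>The block diagonal matrix with blocks 1 and \<open>V'\<close>; accordingly
    \<open>d\<close> puts the eigenvalue r in front of \<open>d'\<close>.\<close>
  define V where "V = mat ?n ?n (\<lambda>(i, j). case (i, j) of (0, 0) \<Rightarrow> 1 | (Suc i', Suc j') \<Rightarrow> V' $$ (i', j') | _ \<Rightarrow> 0)"
  define d where "d = case_nat r d'"
  have V: "V \<in> carrier_mat ?n ?n" by (simp add: V_def)
  have "unitary_mat ?n V"
  proof (rule unitary_matI[OF V], rule eq_matI)
    fix i j assume "i < dim_row (1\<^sub>m ?n)" "j < dim_col (1\<^sub>m ?n)"
    then have ij: "i < ?n" "j < ?n" by auto
    have "(mat_adjoint V' * V') $$ (k, l) = (if k = l then 1 else 0)" if "k < n" "l < n" for k l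
      using V' that by (simp add: unitary_mat_def)
    then have "(\<Sum>m<n. cnj (V' $$ (m, k)) * V' $$ (m, l)) = (if k = l then 1 else 0)"
      if "k < n" "l < n" for k l
      using that cV' by (simp add: mat_mult_index[of _ n n _ n] del: index_mult_mat)
    then show "(mat_adjoint V * V) $$ (i, j) = 1\<^sub>m ?n $$ (i, j)"
      using ij V by (simp add: mat_mult_index[of _ ?n ?n _ ?n] sum.lessThan_Suc_shift V_def
          split: nat.split del: index_mult_mat sum.lessThan_Suc)
  qed (use V in auto)
  moreover have "M = spectral_mat ?n V (\<lambda>k. complex_of_real (d k))"
  proof (rule eq_matI)
    fix i j assume "i < dim_row (spectral_mat ?n V (\<lambda>k. complex_of_real (d k)))"
      "j < dim_col (spectral_mat ?n V (\<lambda>k. complex_of_real (d k)))"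
    then have ij: "i < ?n" "j < ?n" using V by auto
    have *: "M $$ (Suc k, Suc l) = (\<Sum>m<n. V' $$ (k, m) * complex_of_real (d' m) * cnj (V' $$ (l, m)))"
      if "k < n" "l < n" for k l
      using arg_cong[OF A'_eq, of "\<lambda>B. B $$ (k, l)"] that by (simp add: A'_def spectral_mat_index[OF cV'])
    show "M $$ (i, j) = spectral_mat ?n V (\<lambda>k. complex_of_real (d k)) $$ (i, j)"
      unfolding spectral_mat_index[OF V ij] using ij M0[of i] M0'[of j] e *
      by (cases i; cases j) (simp_all add: sum.lessThan_Suc_shift V_def d_def
          del: sum.lessThan_Suc)
  qed (use M V in auto)
  moreover have "A = W * M * mat_adjoint W"
  proof -
    have "W * M * mat_adjoint W = (W * mat_adjoint W) * A * (W * mat_adjoint W)"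
      using A cW by (simp add: M_def assoc_mult_mat[of _ ?n ?n _ ?n _ ?n])
    then show ?thesis using W A by (simp add: unitary_mat_def)
  qed
  ultimately show ?case
    using conj_spectral_mat[OF cW V] unitary_mat_mult[OF W] by metis
qed

section \<open>Intertwining relations and columns of the eigenbasis\<close>

lemma spectral_mat_mult_right:
  assumes "unitary_mat n V"
  shows "spectral_mat n V f * V = V * mat_diag n f"
  using assms
  by (simp add: spectral_mat_def unitary_mat_def assoc_mult_mat[of _ n n _ n _ n] mult_carrier_mat[of _ n n _ n]
      right_mult_one_mat[of _ n n])

lemma adjoint_mult_spectral_mat:
  assumes "unitary_mat n V"
  shows "mat_adjoint V * spectral_mat n V f = mat_diag n f * mat_adjoint V"
proof -
  note c = unitary_mat_carrier[OF assms]
  have "mat_adjoint V * spectral_mat n V f = (mat_adjoint V * V) * (mat_diag n f * mat_adjoint V)"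
    using c by (simp add: spectral_mat_def assoc_mult_mat[of _ n n _ n _ n] mult_carrier_mat[of _ n n _ n])
  then show ?thesis using assms c by (simp add: unitary_mat_def mult_carrier_mat[of _ n n _ n]
      left_mult_one_mat[of _ n n])
qed

lemma spectral_mat_col:
  assumes V: "unitary_mat n V" and k: "k < n"
  shows "spectral_mat n V f *\<^sub>v col V k = f k \<cdot>\<^sub>v col V k"
proof -
  note c = unitary_mat_carrier[OF V]
  have "spectral_mat n V f *\<^sub>v col V k = col (V * mat_diag n f) k"
    unfolding spectral_mat_mult_right[OF V, symmetric]
    using c k by (intro col_mult2[of _ n n _ n, symmetric]) auto
  also have "\<dots> = f k \<cdot>\<^sub>v col V k"
    using c k by (intro eq_vecI) (auto simp: mat_diag_mult_right)
  finally show ?thesis .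
qed

lemma cscalar_prod_cols_unitary:
  assumes "unitary_mat n V" "i < n" "j < n"
  shows "col V j \<bullet>c col V i = (if i = j then 1 else 0)"
proof -
  note c = unitary_mat_carrier[OF assms(1)]
  have "col V j \<bullet>c col V i = (mat_adjoint V * V) $$ (i, j)"
    using c assms by (simp add: mat_mult_index[of _ n n _ n] cscalar_prod_sum[of _ n] mult.commute
        del: index_mult_mat)
  then show ?thesis using assms by (simp add: unitary_mat_def)
qed

section \<open>The trace norm\<close>

text \<open>Testing the quadratic form on the k-th eigenvector returns \<open>d k\<close>.\<close>

lemma spectral_mat_psd_nonneg:
  assumes V: "unitary_mat n V" and k: "k < n"
    and psd: "positive_semidefinite (spectral_mat n V (\<lambda>k. complex_of_real (d k)))"
  shows "d k \<ge> 0"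
proof -
  note c = unitary_mat_carrier[OF V]
  have "0 \<le> Re ((spectral_mat n V (\<lambda>k. complex_of_real (d k)) *\<^sub>v col V k) \<bullet>c col V k)"
    using psd c k by (auto simp: positive_semidefinite_def)
  also have "\<dots> = d k"
    using c k by (simp add: spectral_mat_col[OF V] cscalar_prod_cols_unitary[OF V])
  finally show ?thesis .
qed

text \<open>With \<open>B\<close> the square root taken eigenvalue by eigenvalue, the quadratic form
  at v is the squared norm of B v.\<close>

lemma spectral_mat_psd:
  assumes V: "unitary_mat n V" and d: "\<And>k. d k \<ge> 0"
  shows "positive_semidefinite (spectral_mat n V (\<lambda>k. complex_of_real (d k)))"
proof -
  note c = unitary_mat_carrier[OF V]
  define B where "B = spectral_mat n V (\<lambda>k. complex_of_real (sqrt (d k)))"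
  have B: "B \<in> carrier_mat n n" using c by (simp add: B_def)
  have adj: "mat_adjoint B = B" unfolding B_def using c by (intro hermitian_adjoint hermitian_spectral_mat) auto
  have sq: "B * B = spectral_mat n V (\<lambda>k. complex_of_real (d k))"
    unfolding B_def using d by (simp add: spectral_mat_mult[OF V] flip: of_real_mult)
  have eq: "(spectral_mat n V (\<lambda>k. complex_of_real (d k)) *\<^sub>v v) \<bullet>c v = (B *\<^sub>v v) \<bullet>c (B *\<^sub>v v)"
    if v: "v \<in> carrier_vec n" for v
    using cscalar_prod_adjoint[OF B mult_mat_vec_carrier[OF B v] v]
    by (simp only: adj sq[symmetric] assoc_mult_mat_vec[OF B B v])
  have pos: "0 \<le> Re (w \<bullet>c w)" for w :: "complex vec"
    using conjugate_square_ge_0_vec[of w] by (simp add: less_eq_complex_def)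
  show ?thesis
    unfolding positive_semidefinite_def
  proof (intro conjI ballI)
    show "hermitian (spectral_mat n V (\<lambda>k. complex_of_real (d k)))"
      using c by (intro hermitian_spectral_mat) auto
  next
    fix v :: "complex vec" assume "v \<in> carrier_vec (dim_row (spectral_mat n V (\<lambda>k. complex_of_real (d k))))"
    then have "v \<in> carrier_vec n" using c by simp
    from eq[OF this] pos[of "B *\<^sub>v v"]
    show "0 \<le> Re ((spectral_mat n V (\<lambda>k. complex_of_real (d k)) *\<^sub>v v) \<bullet>c v)" by (simp only:)
  qed
qed

text \<open>The overlap matrix \<open>Q\<close> compares the two eigenbases. Equality of the squares
  says that \<open>Q $$ (i, j)\<close> vanishes unless the squares of \<open>b i\<close> and
  \<open>c j\<close> agree, and for nonnegative eigenvalues this forces \<open>b i = c j\<close>. So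
  B and C have the same matrix elements between the two bases.\<close>

lemma psd_sqrt_unique:
  assumes B: "B \<in> carrier_mat n n" "positive_semidefinite B"
    and C: "C \<in> carrier_mat n n" "positive_semidefinite C"
    and eq: "B * B = C * C"
  shows "B = C"
proof -
  obtain V b where V: "unitary_mat n V" and Bs: "B = spectral_mat n V (\<lambda>k. complex_of_real (b k))"
    using hermitian_spectral[OF B(1)] B(2) by (auto simp: positive_semidefinite_def)
  obtain W c where W: "unitary_mat n W" and Cs: "C = spectral_mat n W (\<lambda>k. complex_of_real (c k))"
    using hermitian_spectral[OF C(1)] C(2) by (auto simp: positive_semidefinite_def)
  note cV = unitary_mat_carrier[OF V] and cW = unitary_mat_carrier[OF W]
  note a = assoc_mult_mat[of _ n n _ n _ n] and m = mult_carrier_mat[of _ n n _ n]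
  let ?D = "\<lambda>d. mat_diag n (\<lambda>k. complex_of_real (d k))"
  define Q where "Q = mat_adjoint V * W"
  have Q: "Q \<in> carrier_mat n n" using cV cW by (simp add: Q_def m)
  \<comment> \<open>Between the two eigenbases, a function of B rescales the rows of
    \<open>Q\<close>, and a function of C rescales its columns.\<close>
  have entry: "(mat_adjoint V * (spectral_mat n V f * W)) $$ (i, j) = f i * Q $$ (i, j)"
    "(mat_adjoint V * (spectral_mat n W f * W)) $$ (i, j) = Q $$ (i, j) * f j"
    if "i < n" "j < n" for f i j
  proof -
    have "mat_adjoint V * (spectral_mat n V f * W) = mat_diag n f * Q"
      using cV cW by (simp add: Q_def m adjoint_mult_spectral_mat[OF V] flip: a)
    then show "(mat_adjoint V * (spectral_mat n V f * W)) $$ (i, j) = f i * Q $$ (i, j)"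
      using that Q by (simp add: mat_diag_mult_left del: index_mult_mat)
    have "mat_adjoint V * (spectral_mat n W f * W) = Q * mat_diag n f"
      using cV cW by (simp add: Q_def m a spectral_mat_mult_right[OF W])
    then show "(mat_adjoint V * (spectral_mat n W f * W)) $$ (i, j) = Q $$ (i, j) * f j"
      using that Q by (simp add: mat_diag_mult_right del: index_mult_mat)
  qed
  have "b i * Q $$ (i, j) = Q $$ (i, j) * c j" if ij: "i < n" "j < n" for i j
  proof -
    have "B * B = spectral_mat n V (\<lambda>k. complex_of_real ((b k)\<^sup>2))"
      "C * C = spectral_mat n W (\<lambda>k. complex_of_real ((c k)\<^sup>2))"
      by (simp_all add: Bs Cs spectral_mat_mult[OF V] spectral_mat_mult[OF W] power2_eq_square)
    then have "complex_of_real ((b i)\<^sup>2) * Q $$ (i, j) = Q $$ (i, j) * complex_of_real ((c j)\<^sup>2)"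
      using entry[OF ij] eq by metis
    then have "complex_of_real ((b i)\<^sup>2 - (c j)\<^sup>2) * Q $$ (i, j) = 0"
      by (simp only: of_real_diff left_diff_distrib) (simp add: mult.commute)
    then have "Q $$ (i, j) = 0 \<or> (b i)\<^sup>2 = (c j)\<^sup>2"
      by (simp only: mult_eq_0_iff of_real_eq_0_iff) auto
    moreover have "b i \<ge> 0" "c j \<ge> 0"
      using spectral_mat_psd_nonneg[OF V ij(1)] spectral_mat_psd_nonneg[OF W ij(2)] B C Bs Cs by auto
    ultimately show ?thesis by (auto simp: power2_eq_iff_nonneg)
  qed
  then have VW: "mat_adjoint V * (B * W) = mat_adjoint V * (C * W)"
    using cV cW B C entry by (intro eq_matI) (auto simp: Bs Cs simp del: index_mult_mat(1))
  \<comment> \<open>Any X is recovered from its matrix elements between the two bases, so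
    \<open>VW\<close> yields B = C.\<close>
  have "X = V * (mat_adjoint V * (X * W)) * mat_adjoint W" if "X \<in> carrier_mat n n" for X
  proof -
    have "V * (mat_adjoint V * (X * W)) * mat_adjoint W = (V * mat_adjoint V) * X * (W * mat_adjoint W)"
      using that cV cW by (simp add: a m)
    then show ?thesis using that V W by (simp add: unitary_mat_def)
  qed
  then show ?thesis using VW B C by metis
qed

text \<open>Replacing each eigenvalue by its modulus gives a positive semidefinite square root of
  the adjoint times the matrix; uniqueness identifies it with the definite description in
  \<open>mat_abs\<close>.\<close>

lemma trace_norm_spectral_mat:
  assumes V: "unitary_mat n V"
  shows "trace_norm (spectral_mat n V (\<lambda>k. complex_of_real (x k))) = (\<Sum>k<n. \<bar>x k\<bar>)"
proof -
  let ?X = "spectral_mat n V (\<lambda>k. complex_of_real (x k))"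
  let ?B = "spectral_mat n V (\<lambda>k. complex_of_real \<bar>x k\<bar>)"
  note c = unitary_mat_carrier[OF V]
  have B: "?B \<in> carrier_mat n n" "positive_semidefinite ?B"
    using c V by (auto intro: spectral_mat_psd)
  have eq: "?B * ?B = mat_adjoint ?X * ?X"
    by (simp only: adjoint_spectral_mat[OF c] spectral_mat_mult[OF V] complex_cnj_complex_of_real
        of_real_mult[symmetric] abs_mult_self_eq)
  have "mat_abs ?X = ?B"
    unfolding mat_abs_def
  proof (rule the_equality)
    show "?B \<in> carrier_mat (dim_col ?X) (dim_col ?X) \<and> positive_semidefinite ?B \<and> ?B * ?B = mat_adjoint ?X * ?X"
      using B eq c by simp
  next
    fix C assume "C \<in> carrier_mat (dim_col ?X) (dim_col ?X) \<and> positive_semidefinite C \<and> C * C = mat_adjoint ?X * ?X"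
    then have C: "C \<in> carrier_mat n n" "positive_semidefinite C" and "C * C = ?B * ?B"
      using eq c by auto
    then show "C = ?B" using psd_sqrt_unique[OF C B] by blast
  qed
  then show ?thesis by (simp add: trace_norm_def mat_trace_spectral_mat[OF V])
qed

section \<open>The matrix exponential\<close>

text \<open>An entry of the m-th power is a finite linear combination of the numbers
  \<open>f k ^ m\<close> with coefficients independent of m, so the entrywise series is a finite sum
  of scalar exponential series.\<close>

lemma mat_exp_spectral_mat:
  assumes V: "unitary_mat n V"
  shows "mat_exp (spectral_mat n V f) = spectral_mat n V (\<lambda>k. exp (f k))"
proof (rule eq_matI)
  note c = unitary_mat_carrier[OF V]
  fix a b assume "a < dim_row (spectral_mat n V (\<lambda>k. exp (f k)))" "b < dim_col (spectral_mat n V (\<lambda>k. exp (f k)))"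
  then have ab: "a < n" "b < n" using c by auto
  have "(\<lambda>m. f k ^ m / fact m) sums exp (f k)" for k
    using exp_converges[of "f k"] by (simp add: scaleR_conv_of_real divide_inverse mult.commute)
  then have "(\<lambda>m. \<Sum>k<n. V $$ (a, k) * (f k ^ m / fact m) * cnj (V $$ (b, k)))
      sums (\<Sum>k<n. V $$ (a, k) * exp (f k) * cnj (V $$ (b, k)))"
    by (intro sums_sum sums_mult sums_mult2)
  moreover have "(spectral_mat n V f ^\<^sub>m m) $$ (a, b) / fact m
      = (\<Sum>k<n. V $$ (a, k) * (f k ^ m / fact m) * cnj (V $$ (b, k)))" for m
    using c ab by (simp add: spectral_mat_pow[OF V] spectral_mat_index sum_divide_distrib)
  ultimately have "(\<lambda>m. (spectral_mat n V f ^\<^sub>m m) $$ (a, b) / fact m)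
      sums (\<Sum>k<n. V $$ (a, k) * exp (f k) * cnj (V $$ (b, k)))"
    by (simp only:)
  from sums_unique[OF this] show "mat_exp (spectral_mat n V f) $$ (a, b) = spectral_mat n V (\<lambda>k. exp (f k)) $$ (a, b)"
    using c ab by (simp add: mat_exp_def spectral_mat_index)
qed (use unitary_mat_carrier[OF V] in \<open>auto simp: mat_exp_def\<close>)

section \<open>Comparison of two evolutions\<close>

text \<open>The Schroedinger equation x' = -i H x, written for one coordinate of x.\<close>

lemma spectral_evolution_derivative:
  fixes d :: "nat \<Rightarrow> real"
  assumes V: "unitary_mat n V" and a: "a \<in> carrier_vec n" and i: "i < n"
  defines "x \<equiv> \<lambda>s::real. spectral_mat n V (\<lambda>k. exp (- (\<i> * complex_of_real s) * complex_of_real (d k))) *\<^sub>v a"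
  shows "((\<lambda>s. x s $ i) has_vector_derivative
     - \<i> * (spectral_mat n V (\<lambda>k. complex_of_real (d k)) *\<^sub>v x s) $ i) (at s)"
proof -
  note c = unitary_mat_carrier[OF V]
  have comp: "(spectral_mat n V f *\<^sub>v a) $ i = (\<Sum>j<n. (\<Sum>k<n. V $$ (i, k) * f k * cnj (V $$ (j, k))) * a $ j)"
    for f
    using c a i by (simp add: mat_vec_index[of _ n n] spectral_mat_index del: index_mult_mat_vec)
  have "((\<lambda>s. exp (- (\<i> * complex_of_real s) * complex_of_real (d k))) has_vector_derivative
     - \<i> * (d k * exp (- (\<i> * complex_of_real s) * complex_of_real (d k)))) (at s)" for k
  proof -
    \<comment> \<open>The derivative is taken in a complex time variable and then restricted to real
      times.\<close>
    have "((\<lambda>z. exp (- (\<i> * z) * complex_of_real (d k))) has_field_derivative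
      - \<i> * (d k * exp (- (\<i> * complex_of_real s) * complex_of_real (d k)))) (at (complex_of_real s))"
      by (auto intro!: derivative_eq_intros)
    then show ?thesis by (rule has_vector_derivative_real_field)
  qed
  then have "((\<lambda>s. x s $ i) has_vector_derivative (\<Sum>j<n. (\<Sum>k<n. V $$ (i, k) *
      (- \<i> * (d k * exp (- (\<i> * complex_of_real s) * complex_of_real (d k)))) * cnj (V $$ (j, k))) * a $ j)) (at s)"
    unfolding x_def comp
    by (intro has_vector_derivative_sum has_vector_derivative_mult_left has_vector_derivative_mult_right)
  moreover have "spectral_mat n V (\<lambda>k. complex_of_real (d k)) *\<^sub>v x s
      = spectral_mat n V (\<lambda>k. d k * exp (- (\<i> * complex_of_real s) * complex_of_real (d k))) *\<^sub>v a"
    unfolding x_def using c a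
    by (simp add: assoc_mult_mat_vec[of _ n n _ n, symmetric] spectral_mat_mult[OF V])
  ultimately show ?thesis
    by (simp add: comp sum_distrib_left sum_distrib_right mult_ac sum_negf)
qed

lemma hermitian_cscalar_prod:
  assumes "A \<in> carrier_mat n n" "hermitian A" "v \<in> carrier_vec n" "w \<in> carrier_vec n"
  shows "(A *\<^sub>v v) \<bullet>c w = v \<bullet>c (A *\<^sub>v w)"
  using cscalar_prod_adjoint[OF assms(1,3,4)] hermitian_adjoint[OF assms(2)] by simp

text \<open>Duhamel's formula in weak form: \<open>g s = Re \<langle>e\<^sup>-\<^sup>i\<^sup>s\<^sup>H a, e\<^sup>-\<^sup>i\<^sup>s\<^sup>H\<^sup>' b\<rangle>\<close> has derivative
  \<open>Re (-i \<langle>(H - H') \<dots>, \<dots>\<rangle>)\<close>; choosing \<open>b\<close> such that \<open>e\<^sup>-\<^sup>i\<^sup>t\<^sup>H\<^sup>' b\<close> is the difference \<open>z\<close> to be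
  estimated gives \<open>g t - g 0 = \<parallel>z\<parallel>\<^sup>2\<close>.\<close>

lemma mat_exp_diff_le:
  assumes H: "H \<in> carrier_mat n n" "hermitian H" and H': "H' \<in> carrier_mat n n" "hermitian H'"
    and bound: "\<And>v. v \<in> carrier_vec n \<Longrightarrow> vec_norm2 ((H - H') *\<^sub>v v) \<le> \<delta> * vec_norm2 v"
    and a: "a \<in> carrier_vec n" and t: "t \<ge> 0"
  shows "vec_norm2 (mat_exp ((- (\<i> * complex_of_real t)) \<cdot>\<^sub>m H) *\<^sub>v a
      - mat_exp ((- (\<i> * complex_of_real t)) \<cdot>\<^sub>m H') *\<^sub>v a) \<le> t * \<delta> * vec_norm2 a"
proof -
  obtain V d where V: "unitary_mat n V" and Hs: "H = spectral_mat n V (\<lambda>k. complex_of_real (d k))"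
    using hermitian_spectral[OF H] by blast
  obtain W e where W: "unitary_mat n W" and Hs': "H' = spectral_mat n W (\<lambda>k. complex_of_real (e k))"
    using hermitian_spectral[OF H'] by blast
  note cV = unitary_mat_carrier[OF V] and cW = unitary_mat_carrier[OF W]
  define E where "E = (\<lambda>s. spectral_mat n V (\<lambda>k. exp (- (\<i> * complex_of_real s) * complex_of_real (d k))))"
  define F where "F = (\<lambda>s. spectral_mat n W (\<lambda>k. exp (- (\<i> * complex_of_real s) * complex_of_real (e k))))"
  have E: "unitary_mat n (E s)" and F: "unitary_mat n (F s)" for s
    unfolding E_def F_def using V W by (auto intro!: unitary_spectral_mat simp: norm_exp_eq_Re)
  note cE = unitary_mat_carrier[OF E] and cF = unitary_mat_carrier[OF F]
  note [simp] = mult_mat_vec_carrier[of _ n n]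
  define z where "z = E t *\<^sub>v a - F t *\<^sub>v a"
  have z: "z \<in> carrier_vec n" using a cE cF by (simp add: z_def)
  define b where "b = mat_adjoint (F t) *\<^sub>v z"
  have b: "b \<in> carrier_vec n" using z cF by (simp add: b_def)
  have Fb: "F t *\<^sub>v b = z"
    using F[of t] cF z by (simp add: b_def assoc_mult_mat_vec[of _ n n _ n, symmetric] unitary_mat_def)
  have norm_b: "vec_norm2 b = vec_norm2 z"
    unfolding b_def using F z by (intro vec_norm2_unitary unitary_mat_adjoint)
  define f where "f = (\<lambda>s. (E s *\<^sub>v a) \<bullet>c (F s *\<^sub>v b))"
  define f' where "f' = (\<lambda>s. - \<i> * (((H - H') *\<^sub>v (E s *\<^sub>v a)) \<bullet>c (F s *\<^sub>v b)))"
  have deriv: "(f has_vector_derivative f' s) (at s)" for s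
  proof -
    define x where "x = (\<lambda>s. E s *\<^sub>v a)"
    define y where "y = (\<lambda>s. F s *\<^sub>v b)"
    have x: "x s \<in> carrier_vec n" and y: "y s \<in> carrier_vec n" for s
      using a b cE cF by (auto simp: x_def y_def)
    have "((\<lambda>s. x s $ i) has_vector_derivative - \<i> * (H *\<^sub>v x s) $ i) (at s)" if "i < n" for i
      unfolding x_def E_def Hs by (rule spectral_evolution_derivative[OF V a that])
    moreover have "((\<lambda>s. cnj (y s $ i)) has_vector_derivative cnj (- \<i> * (H' *\<^sub>v y s) $ i)) (at s)" if "i < n" for i
      unfolding y_def F_def Hs'
      by (rule bounded_linear.has_vector_derivative[OF bounded_linear_cnj spectral_evolution_derivative[OF W b that]])
    ultimately have "((\<lambda>s. \<Sum>i<n. x s $ i * cnj (y s $ i)) has_vector_derivative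
        (\<Sum>i<n. x s $ i * cnj (- \<i> * (H' *\<^sub>v y s) $ i) + - \<i> * (H *\<^sub>v x s) $ i * cnj (y s $ i))) (at s)"
      by (intro has_vector_derivative_sum has_vector_derivative_mult) auto
    moreover have "f = (\<lambda>s. \<Sum>i<n. x s $ i * cnj (y s $ i))"
      using cscalar_prod_sum[OF x y] unfolding f_def x_def y_def by (rule ext)
    moreover have "f' s = (\<Sum>i<n. x s $ i * cnj (- \<i> * (H' *\<^sub>v y s) $ i) + - \<i> * (H *\<^sub>v x s) $ i * cnj (y s $ i))"
    proof -
      have "((H - H') *\<^sub>v x s) \<bullet>c y s = (H *\<^sub>v x s) \<bullet>c y s - (H' *\<^sub>v x s) \<bullet>c y s"
        using H H' x y by (simp add: minus_mult_distrib_mat_vec[of _ n n] minus_scalar_prod_distrib[of _ n])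
      \<comment> \<open>Moving H' across the inner product brings the two terms of the product rule
        together as the single operator H - H'.\<close>
      also have "(H' *\<^sub>v x s) \<bullet>c y s = x s \<bullet>c (H' *\<^sub>v y s)"
        using H' x y by (intro hermitian_cscalar_prod)
      also have "(H *\<^sub>v x s) \<bullet>c y s = (\<Sum>i<n. (H *\<^sub>v x s) $ i * cnj (y s $ i))"
        using H x y by (intro cscalar_prod_sum) auto
      also have "x s \<bullet>c (H' *\<^sub>v y s) = (\<Sum>i<n. x s $ i * cnj ((H' *\<^sub>v y s) $ i))"
        using H' x y by (intro cscalar_prod_sum) auto
      finally have "f' s = - \<i> * ((\<Sum>i<n. (H *\<^sub>v x s) $ i * cnj (y s $ i))
          - (\<Sum>i<n. x s $ i * cnj ((H' *\<^sub>v y s) $ i)))"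
        by (simp only: f'_def x_def y_def)
      then show ?thesis
        by (simp add: sum_distrib_left sum.distrib sum_subtractf sum_negf algebra_simps del: index_mult_mat_vec)
    qed
    ultimately show ?thesis by simp
  qed
  \<comment> \<open>Both evolutions preserve the norm, so the bound does not depend on s.\<close>
  have f'_le: "Re (f' s) \<le> \<delta> * vec_norm2 a * vec_norm2 z" for s
  proof -
    have "Re (f' s) \<le> cmod (f' s)" by (rule complex_Re_le_cmod)
    also have "\<dots> \<le> vec_norm2 ((H - H') *\<^sub>v (E s *\<^sub>v a)) * vec_norm2 (F s *\<^sub>v b)"
      unfolding f'_def norm_mult using H H' cE cF a b
      by simp (intro cscalar_prod_Cauchy_Schwarz[of _ n], auto simp: minus_carrier_mat)
    also have "\<dots> \<le> \<delta> * vec_norm2 (E s *\<^sub>v a) * vec_norm2 (F s *\<^sub>v b)"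
      using cE a by (intro mult_right_mono bound vec_norm2_nonneg) auto
    finally show ?thesis using a b by (simp add: vec_norm2_unitary[OF E] vec_norm2_unitary[OF F] norm_b)
  qed
  have "((\<lambda>s. Re (f s)) has_real_derivative Re (f' s)) (at s)" for s
    unfolding has_real_derivative_iff_has_vector_derivative
    by (rule bounded_linear.has_vector_derivative[OF bounded_linear_Re deriv])
  then have "Re (f t) - Re (f 0) \<le> t * (\<delta> * vec_norm2 a * vec_norm2 z)"
  \<comment> \<open>The mean value theorem needs a nondegenerate interval, so t = 0 is treated
    apart.\<close>
  proof (cases "t = 0")
    case False
    then obtain s where "Re (f t) - Re (f 0) = (t - 0) * Re (f' s)"
      using MVT2[of 0 t "\<lambda>s. Re (f s)" "\<lambda>s. Re (f' s)"] t
        \<open>\<And>s. ((\<lambda>s. Re (f s)) has_real_derivative Re (f' s)) (at s)\<close> by auto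
    then show ?thesis using t f'_le[of s] by (simp add: mult_left_mono)
  qed simp
  moreover have "Re (f t) - Re (f 0) = (vec_norm2 z)\<^sup>2"
  proof -
    have "E 0 *\<^sub>v a = a" "F 0 *\<^sub>v b = b"
      using a b by (simp_all add: E_def F_def spectral_mat_one[OF V] spectral_mat_one[OF W])
    then have "f 0 = a \<bullet>c b" by (simp add: f_def)
    \<comment> \<open>Applying the unitary \<open>F t\<close> to both arguments brings the value at
      time 0 to the vector z, so that the difference of the values at t and 0 is the inner product
      of z with itself.\<close>
    also have "\<dots> = (F t *\<^sub>v a) \<bullet>c z"
      using cscalar_prod_unitary[OF F a b, of t] Fb by simp
    finally have "f t - f 0 = z \<bullet>c z"
      using cE cF a z by (simp add: f_def Fb z_def minus_scalar_prod_distrib[of _ n])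
    also have "\<dots> = complex_of_real ((vec_norm2 z)\<^sup>2)" using vec_norm2_square[OF z] by simp
    finally show ?thesis by (metis Re_complex_of_real minus_complex.sel(1))
  qed
  ultimately have "vec_norm2 z * vec_norm2 z \<le> (t * \<delta> * vec_norm2 a) * vec_norm2 z"
    by (simp add: power2_eq_square mult_ac)
  \<comment> \<open>Cancelling the norm of z requires it to be nonzero. If it is zero, the
    right-hand side must be shown nonnegative; as no sign of \<delta> is assumed here, this is read
    off from \<open>bound\<close> at a.\<close>
  moreover have "vec_norm2 z \<le> t * \<delta> * vec_norm2 a" if "vec_norm2 z = 0"
  proof -
    have "0 \<le> \<delta> * vec_norm2 a"
      using bound[OF a] vec_norm2_nonneg[of "(H - H') *\<^sub>v a"] by linarith
    then show ?thesis using t that by (simp add: mult.assoc)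
  qed
  ultimately have "vec_norm2 z \<le> t * \<delta> * vec_norm2 a"
    using vec_norm2_nonneg[of z] by (cases "vec_norm2 z = 0") auto
  moreover have "mat_exp ((- (\<i> * complex_of_real t)) \<cdot>\<^sub>m H) = E t"
    "mat_exp ((- (\<i> * complex_of_real t)) \<cdot>\<^sub>m H') = F t"
    using cV cW by (simp_all add: Hs Hs' E_def F_def smult_spectral_mat mat_exp_spectral_mat V W)
  ultimately show ?thesis by (simp add: z_def)
qed

section \<open>From vectors to the trace norm\<close>

lemma vec_norm2_col_unitary:
  assumes "unitary_mat n V" "k < n"
  shows "vec_norm2 (col V k) = 1"
  by (simp add: vec_norm2_def cscalar_prod_cols_unitary[OF assms(1,2,2)])

text \<open>Factor the difference of squares, apply the reverse triangle inequality to one factor,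
  then Cauchy-Schwarz. For unit vectors the last factor is 2.\<close>

lemma sum_abs_diff_cmod_squares_le:
  assumes x: "x \<in> carrier_vec n" and y: "y \<in> carrier_vec n"
  shows "(\<Sum>i<n. \<bar>(cmod (x $ i))\<^sup>2 - (cmod (y $ i))\<^sup>2\<bar>)
    \<le> vec_norm2 (x - y) * (vec_norm2 x + vec_norm2 y)"
proof -
  have "(\<Sum>i<n. \<bar>(cmod (x $ i))\<^sup>2 - (cmod (y $ i))\<^sup>2\<bar>)
      \<le> (\<Sum>i<n. \<bar>cmod ((x - y) $ i)\<bar> * \<bar>cmod (x $ i) + cmod (y $ i)\<bar>)"
  proof (rule sum_mono)
    fix i assume "i \<in> {..<n}"
    then have "\<bar>cmod (x $ i) - cmod (y $ i)\<bar> \<le> cmod ((x - y) $ i)"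
      using x y by (simp add: norm_triangle_ineq3)
    moreover have "(cmod (x $ i))\<^sup>2 - (cmod (y $ i))\<^sup>2 = (cmod (x $ i) - cmod (y $ i)) * (cmod (x $ i) + cmod (y $ i))"
      by (simp add: power2_eq_square algebra_simps)
    ultimately show "\<bar>(cmod (x $ i))\<^sup>2 - (cmod (y $ i))\<^sup>2\<bar>
        \<le> \<bar>cmod ((x - y) $ i)\<bar> * \<bar>cmod (x $ i) + cmod (y $ i)\<bar>"
      by (simp add: abs_mult mult_right_mono)
  qed
  also have "\<dots> \<le> L2_set (\<lambda>i. cmod ((x - y) $ i)) {..<n} * L2_set (\<lambda>i. cmod (x $ i) + cmod (y $ i)) {..<n}"
    by (rule L2_set_mult_ineq)
  also have "\<dots> \<le> vec_norm2 (x - y) * (vec_norm2 x + vec_norm2 y)"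
    using x y L2_set_triangle_ineq[of "\<lambda>i. cmod (x $ i)" "\<lambda>i. cmod (y $ i)"]
    by (auto simp: vec_norm2_L2_set[of _ n] intro!: mult_left_mono)
  finally show ?thesis .
qed

text \<open>In the eigenbasis \<open>V\<close> of the difference X, each eigenvalue of X is an
  average, with the eigenvalues \<open>p\<close> of the state as weights, of differences of squared
  moduli of matrix entries. Summing the moduli over i first reduces the claim to one eigenvector of
  the state at a time.\<close>

lemma trace_norm_conj_diff_le:
  assumes E: "unitary_mat n E" and F: "unitary_mat n F" and \<rho>: "density_operator n \<rho>"
    and close: "\<And>a. a \<in> carrier_vec n \<Longrightarrow> vec_norm2 (E *\<^sub>v a - F *\<^sub>v a) \<le> c * vec_norm2 a"
  shows "trace_norm (conj_by E \<rho> - conj_by F \<rho>) \<le> 2 * c"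
proof -
  note cE = unitary_mat_carrier[OF E] and cF = unitary_mat_carrier[OF F]
  note a = assoc_mult_mat[of _ n n _ n _ n] and [simp] = mult_carrier_mat[of _ n n _ n]
  have c\<rho>: "\<rho> \<in> carrier_mat n n" "hermitian \<rho>"
    using \<rho> by (auto simp: density_operator_def positive_semidefinite_def)
  obtain P p where P: "unitary_mat n P" and \<rho>s: "\<rho> = spectral_mat n P (\<lambda>k. complex_of_real (p k))"
    using hermitian_spectral[OF c\<rho>] by blast
  note cP = unitary_mat_carrier[OF P]
  have p: "p k \<ge> 0" if "k < n" for k
    using spectral_mat_psd_nonneg[OF P that] \<rho> \<rho>s by (simp add: density_operator_def)
  have "complex_of_real (\<Sum>k<n. p k) = 1"
    using \<rho> mat_trace_spectral_mat[OF P] by (simp add: density_operator_def \<rho>s)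
  then have sum_p: "(\<Sum>k<n. p k) = 1" by (simp only: of_real_eq_1_iff)
  define X where "X = conj_by E \<rho> - conj_by F \<rho>"
  have cX: "X \<in> carrier_mat n n" using cE cF c\<rho> by (simp add: X_def conj_by_def minus_carrier_mat[of _ n n])
  have Xs: "X = spectral_mat n (E * P) (\<lambda>k. complex_of_real (p k)) - spectral_mat n (F * P) (\<lambda>k. complex_of_real (p k))"
    using cE cF cP by (simp add: X_def conj_by_def \<rho>s conj_spectral_mat)
  have "hermitian X"
    unfolding Xs using cE cF cP cX
    by (intro hermitianI[of _ n]) (auto simp: mat_adjoint_minus[of _ n n] adjoint_spectral_mat)
  then obtain V x where V: "unitary_mat n V" and X_eq: "X = spectral_mat n V (\<lambda>k. complex_of_real (x k))"
    using hermitian_spectral[OF cX] by blast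
  note cV = unitary_mat_carrier[OF V]
  define A where "A = mat_adjoint V * (E * P)"
  define B where "B = mat_adjoint V * (F * P)"
  have A: "unitary_mat n A" and B: "unitary_mat n B"
    unfolding A_def B_def using V E F P by (auto intro!: unitary_mat_mult unitary_mat_adjoint)
  note cA = unitary_mat_carrier[OF A] and cB = unitary_mat_carrier[OF B]
  have x: "x i = (\<Sum>k<n. p k * ((cmod (A $$ (i, k)))\<^sup>2 - (cmod (B $$ (i, k)))\<^sup>2))" if i: "i < n" for i
  proof -
    \<comment> \<open>X is diagonal in its own eigenbasis, so its eigenvalues can be read off from
      the diagonal of the difference of the two conjugated states.\<close>
    have "mat_diag n (\<lambda>k. complex_of_real (x k)) = mat_adjoint V * X * V"
      using cV V by (simp add: X_eq adjoint_mult_spectral_mat[OF V] a)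
        (simp add: unitary_mat_def right_mult_one_mat[of _ n n])
    also have "\<dots> = spectral_mat n A (\<lambda>k. complex_of_real (p k)) - spectral_mat n B (\<lambda>k. complex_of_real (p k))"
      using cV cE cF cP
      by (simp add: Xs A_def B_def mult_minus_distrib_mat[of _ n n _ n] minus_mult_distrib_mat[of _ n n _ _ n]
          conj_spectral_mat[of "mat_adjoint V" n, symmetric])
    finally have "mat_diag n (\<lambda>k. complex_of_real (x k)) $$ (i, i)
        = (spectral_mat n A (\<lambda>k. complex_of_real (p k)) - spectral_mat n B (\<lambda>k. complex_of_real (p k))) $$ (i, i)"
      by simp
    then have "complex_of_real (x i) = (\<Sum>k<n. A $$ (i, k) * p k * cnj (A $$ (i, k)))
        - (\<Sum>k<n. B $$ (i, k) * p k * cnj (B $$ (i, k)))"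
      using i cA cB by (simp add: spectral_mat_index) (simp add: mat_diag_def)
    also have "\<dots> = complex_of_real (\<Sum>k<n. p k * ((cmod (A $$ (i, k)))\<^sup>2 - (cmod (B $$ (i, k)))\<^sup>2))"
      unfolding of_real_sum of_real_mult of_real_diff complex_norm_square
      by (simp add: sum_subtractf algebra_simps)
    finally show ?thesis by (simp only: of_real_eq_iff)
  qed
  have col_le: "(\<Sum>i<n. \<bar>(cmod (A $$ (i, k)))\<^sup>2 - (cmod (B $$ (i, k)))\<^sup>2\<bar>) \<le> 2 * c" if k: "k < n" for k
  proof -
    \<comment> \<open>Columns k of \<open>A\<close> and \<open>B\<close> are the two images of the
      k-th eigenvector of the state, in the coordinates of \<open>V\<close>: unit vectors at
      distance at most c.\<close>
    have cols: "col A k = mat_adjoint V *\<^sub>v (E *\<^sub>v col P k)" "col B k = mat_adjoint V *\<^sub>v (F *\<^sub>v col P k)"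
      using cV cE cF cP k by (simp_all add: A_def B_def col_mult2[of _ n n _ n] del: col_mult)
    have cc: "col P k \<in> carrier_vec n" using cP by auto
    have "col A k - col B k = mat_adjoint V *\<^sub>v (E *\<^sub>v col P k - F *\<^sub>v col P k)"
      unfolding cols using cV cE cF cc
      by (intro mult_minus_distrib_mat_vec[of _ n n, symmetric]) (auto intro: mult_mat_vec_carrier[of _ n n])
    then have "vec_norm2 (col A k - col B k) = vec_norm2 (E *\<^sub>v col P k - F *\<^sub>v col P k)"
      using cE cF cc
      by (simp add: vec_norm2_unitary[OF unitary_mat_adjoint[OF V]] mult_mat_vec_carrier[of _ n n])
    also have "\<dots> \<le> c" using close[OF cc] by (simp add: vec_norm2_col_unitary[OF P k])
    finally have "vec_norm2 (col A k - col B k) \<le> c" .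
    moreover have "(\<Sum>i<n. \<bar>(cmod (col A k $ i))\<^sup>2 - (cmod (col B k $ i))\<^sup>2\<bar>)
        \<le> vec_norm2 (col A k - col B k) * (vec_norm2 (col A k) + vec_norm2 (col B k))"
      using cA cB k by (intro sum_abs_diff_cmod_squares_le) auto
    ultimately show ?thesis
      using cA cB k by (simp add: vec_norm2_col_unitary[OF A k] vec_norm2_col_unitary[OF B k])
  qed
  have "trace_norm X = (\<Sum>i<n. \<bar>x i\<bar>)"
    unfolding X_eq by (rule trace_norm_spectral_mat[OF V])
  also have "\<dots> \<le> (\<Sum>i<n. \<Sum>k<n. p k * \<bar>(cmod (A $$ (i, k)))\<^sup>2 - (cmod (B $$ (i, k)))\<^sup>2\<bar>)"
    using p by (intro sum_mono) (auto simp: x abs_mult intro!: order_trans[OF sum_abs] sum_mono)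
  also have "\<dots> = (\<Sum>k<n. p k * (\<Sum>i<n. \<bar>(cmod (A $$ (i, k)))\<^sup>2 - (cmod (B $$ (i, k)))\<^sup>2\<bar>))"
    by (subst sum.swap) (simp add: sum_distrib_left)
  also have "\<dots> \<le> (\<Sum>k<n. p k * (2 * c))"
    using p col_le by (intro sum_mono mult_left_mono) auto
  \<comment> \<open>The weights add up to the trace of the state, which is 1.\<close>
  also have "\<dots> = 2 * c" using sum_p by (simp flip: sum_distrib_right)
  finally show ?thesis by (simp add: X_def)
qed

lemma trace_norm_evolve_diff_le:
  assumes H: "H \<in> carrier_mat n n" "hermitian H" and H': "H' \<in> carrier_mat n n" "hermitian H'"
    and bound: "\<And>v. v \<in> carrier_vec n \<Longrightarrow> vec_norm2 ((H - H') *\<^sub>v v) \<le> \<delta> * vec_norm2 v"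
    and \<rho>: "density_operator n \<rho>" and t: "t \<ge> 0"
  shows "trace_norm (evolve H t \<rho> - evolve H' t \<rho>) \<le> 2 * t * \<delta>"
proof -
  define E where "E = (\<lambda>H. mat_exp ((- (\<i> * complex_of_real t)) \<cdot>\<^sub>m H))"
  have *: "unitary_mat n (E H) \<and> evolve H t \<rho> = conj_by (E H) \<rho>"
    if H: "H \<in> carrier_mat n n" "hermitian H" for H
  proof -
    obtain V d where V: "unitary_mat n V" and Hs: "H = spectral_mat n V (\<lambda>k. complex_of_real (d k))"
      using hermitian_spectral[OF H] by blast
    note c = unitary_mat_carrier[OF V]
    have e: "E H = spectral_mat n V (\<lambda>k. exp (- (\<i> * complex_of_real t) * complex_of_real (d k)))"
      using c by (simp add: Hs E_def smult_spectral_mat mat_exp_spectral_mat[OF V])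
    \<comment> \<open>This makes the right factor of \<open>evolve\<close> the adjoint of the left
      one, so that the evolution is a conjugation by a unitary.\<close>
    have "cnj (exp z) = exp (cnj z)" for z :: complex by (simp add: exp_eq_polar cis_cnj)
    then have "mat_exp ((\<i> * complex_of_real t) \<cdot>\<^sub>m H) = mat_adjoint (E H)"
      using c by (simp add: Hs e[unfolded Hs] adjoint_spectral_mat smult_spectral_mat mat_exp_spectral_mat[OF V])
    moreover have "unitary_mat n (E H)"
      unfolding e by (intro unitary_spectral_mat V) (simp add: norm_exp_eq_Re)
    ultimately show ?thesis by (simp add: evolve_def conj_by_def E_def)
  qed
  have "trace_norm (conj_by (E H) \<rho> - conj_by (E H') \<rho>) \<le> 2 * (t * \<delta>)"
    using *[OF H] *[OF H'] \<rho> mat_exp_diff_le[OF H H' bound _ t]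
    by (intro trace_norm_conj_diff_le) (auto simp: E_def)
  then show ?thesis using *[OF H] *[OF H'] by simp
qed

section \<open>Unitaries that preserve energy windows\<close>

lemma hermitian_eigenspace_orthogonal:
  assumes C: "C \<in> carrier_mat n n" "hermitian C" and v: "v \<in> carrier_vec n" and w: "w \<in> carrier_vec n"
    and "C *\<^sub>v v = complex_of_real a \<cdot>\<^sub>v v" "C *\<^sub>v w = complex_of_real b \<cdot>\<^sub>v w" "a \<noteq> b"
  shows "v \<bullet>c w = 0"
proof -
  have "complex_of_real a * (v \<bullet>c w) = complex_of_real b * (v \<bullet>c w)"
    using hermitian_cscalar_prod[OF C v w] assms(5,6) v w
    by (simp add: conjugate_smult_vec)
  then show ?thesis using \<open>a \<noteq> b\<close> by simp
qed

text \<open>The coordinates of w in the basis \<open>V\<close> vanish at every k with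
  \<open>d k\<close> different from E, so only the values of \<open>g\<close> at the remaining
  indices are felt. This is needed because window spaces are spanned by arbitrary eigenvectors, not
  just by columns of \<open>V\<close>.\<close>

lemma spectral_mat_eigenvector:
  assumes V: "unitary_mat n V" and w: "w \<in> carrier_vec n"
    and ev: "spectral_mat n V (\<lambda>k. complex_of_real (d k)) *\<^sub>v w = complex_of_real E \<cdot>\<^sub>v w"
    and g: "\<And>k. k < n \<Longrightarrow> d k = E \<Longrightarrow> g k = c"
  shows "spectral_mat n V g *\<^sub>v w = c \<cdot>\<^sub>v w"
proof -
  note cV = unitary_mat_carrier[OF V]
  note a = assoc_mult_mat_vec[of _ n n _ n]
  define y where "y = mat_adjoint V *\<^sub>v w"
  have y: "y \<in> carrier_vec n" using cV w by (auto simp: y_def intro: mult_mat_vec_carrier[of _ n n])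
  have Vy: "V *\<^sub>v y = w" using V cV w by (simp add: y_def a[symmetric]) (simp add: unitary_mat_def)
  have diag: "(mat_diag n f *\<^sub>v y) $ k = f k * y $ k" if "k < n" for f k
    using that y by (subst mat_vec_index[of _ n n])
      (auto simp: mat_diag_def if_distrib[of "\<lambda>z. z * _"] cong: if_cong)
  have "mat_diag n (\<lambda>k. complex_of_real (d k)) *\<^sub>v y
      = mat_adjoint V *\<^sub>v (spectral_mat n V (\<lambda>k. complex_of_real (d k)) *\<^sub>v w)"
    using cV w by (simp add: y_def a[symmetric] adjoint_mult_spectral_mat[OF V])
  also have "\<dots> = complex_of_real E \<cdot>\<^sub>v y"
    using cV w by (simp add: ev y_def mult_mat_vec[of _ n n])
  finally have dy: "mat_diag n (\<lambda>k. complex_of_real (d k)) *\<^sub>v y = complex_of_real E \<cdot>\<^sub>v y" .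
  have "mat_diag n g *\<^sub>v y = c \<cdot>\<^sub>v y"
  proof (rule eq_vecI)
    fix k assume "k < dim_vec (c \<cdot>\<^sub>v y)"
    then have k: "k < n" using y by simp
    have "complex_of_real (d k) * y $ k = complex_of_real E * y $ k"
      using arg_cong[OF dy, of "\<lambda>v. v $ k"] k y by (simp add: diag del: index_mult_mat_vec)
    then have "d k = E \<or> y $ k = 0" by auto
    then show "(mat_diag n g *\<^sub>v y) $ k = (c \<cdot>\<^sub>v y) $ k"
      using g[OF k] k y by (auto simp: diag simp del: index_mult_mat_vec(1))
  qed (use y in \<open>simp add: mat_diag_def\<close>)
  moreover have "spectral_mat n V g *\<^sub>v w = V *\<^sub>v (mat_diag n g *\<^sub>v y)"
    using cV w y by (simp add: spectral_mat_def y_def a mult_carrier_mat[of _ n n _ n]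
        mult_mat_vec_carrier[of _ n n])
  ultimately show ?thesis using cV y Vy by (simp add: mult_mat_vec[of _ n n])
qed

text \<open>An eigenspace of \<open>C\<close> is a subspace, so once it contains the spanning
  eigenvectors it contains their span.\<close>

lemma window_space_subset_eigenspace:
  assumes C: "C \<in> carrier_mat n n" and H: "H \<in> carrier_mat n n"
    and ev: "\<And>w E. E \<in> J \<Longrightarrow> eigenvector H w (complex_of_real E) \<Longrightarrow> C *\<^sub>v w = c \<cdot>\<^sub>v w"
  shows "window_space H J \<subseteq> {w \<in> carrier_vec n. C *\<^sub>v w = c \<cdot>\<^sub>v w}"
proof -
  interpret vec_space "TYPE(complex)" n .
  have "submodule class_ring {w \<in> carrier_vec n. C *\<^sub>v w = c \<cdot>\<^sub>v w} V"
    unfolding submodule_def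
    using C by (auto simp: module_vec_simps mult_add_distrib_mat_vec[of _ n n] smult_add_distrib_vec[of _ n]
        mult_mat_vec[of _ n n] smult_smult_assoc mult.commute module_axioms class_ring_simps)
  moreover have "{v. \<exists>E \<in> J. eigenvector H v (complex_of_real E)} \<subseteq> {w \<in> carrier_vec n. C *\<^sub>v w = c \<cdot>\<^sub>v w}"
    using ev H by (auto simp: eigenvector_def)
  ultimately have "span {v. \<exists>E \<in> J. eigenvector H v (complex_of_real E)} \<subseteq> {w \<in> carrier_vec n. C *\<^sub>v w = c \<cdot>\<^sub>v w}"
    by (intro span_is_subset)
  then show ?thesis using H by (simp add: window_space_def)
qed

lemma eigenvector_in_window_space:
  assumes H: "H \<in> carrier_mat n n" and "E \<in> J" "eigenvector H w (complex_of_real E)"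
  shows "w \<in> window_space H J"
proof -
  interpret vec_space "TYPE(complex)" n .
  have "{v. \<exists>E \<in> J. eigenvector H v (complex_of_real E)} \<subseteq> carrier_vec n"
    using H by (auto simp: eigenvector_def)
  then have "{v. \<exists>E \<in> J. eigenvector H v (complex_of_real E)}
      \<subseteq> span {v. \<exists>E \<in> J. eigenvector H v (complex_of_real E)}"
    by (intro in_own_span) (simp add: module_vec_simps)
  then show ?thesis using assms by (auto simp: window_space_def)
qed

text \<open>The bound is stated for vectors because it feeds both the operator norm estimate and the
  comparison of evolutions.\<close>

lemma ensemble_vec_norm2_diff_le:
  assumes H: "H \<in> carrier_mat n n" "hermitian H" and \<delta>: "\<delta> > 0"
    and win: "energy_windows H \<delta> K I" and U: "U \<in> ensemble H K I" and v: "v \<in> carrier_vec n"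
  shows "vec_norm2 ((H - conj_by U H) *\<^sub>v v) \<le> \<delta> * vec_norm2 v"
proof -
  obtain V d where V: "unitary_mat n V" and Hs: "H = spectral_mat n V (\<lambda>k. complex_of_real (d k))"
    using hermitian_spectral[OF H] by blast
  note cV = unitary_mat_carrier[OF V]
  obtain E0 where I: "\<And>j. j < K \<Longrightarrow> I j \<subseteq> {E0 + real j * \<delta> .. E0 + real (j + 1) * \<delta>}"
    using win by (auto simp: energy_windows_def)
  have disj: "i = j" if "i < K" "j < K" "E \<in> I i" "E \<in> I j" for i j E
    using win that disjoint_family_onD[of I "{..<K}" i j] unfolding energy_windows_def by blast
  obtain u where u: "\<And>j. j < K \<Longrightarrow> unitary_on (window_space H (I j)) (u j)"
    and Uu: "\<And>j w. j < K \<Longrightarrow> w \<in> window_space H (I j) \<Longrightarrow> U *\<^sub>v w = u j w"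
    using U by (auto simp: ensemble_def)
  have cU: "U \<in> carrier_mat n n" using U H by (auto simp: ensemble_def)
  have col_ev: "eigenvector H (col V k) (complex_of_real (d k))" if k: "k < n" for k
  proof -
    have "col V k \<noteq> 0\<^sub>v n" using cscalar_prod_cols_unitary[OF V k k] by auto
    then show ?thesis using cV k H spectral_mat_col[OF V k] by (auto simp: eigenvector_def Hs)
  qed
  have "\<exists>j<K. d k \<in> I j" if "k < n" for k
    using win col_ev[OF that] by (auto simp: energy_windows_def eigenvalue_def)
  then obtain J where J: "\<And>k. k < n \<Longrightarrow> J k < K \<and> d k \<in> I (J k)" by metis
  \<comment> \<open>\<open>c j\<close> is the centre of the j-th window, and \<open>J k\<close> is a
    window that contains the energy of column k.\<close>
  define c where "c = (\<lambda>j. E0 + (real j + 1 / 2) * \<delta>)"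
  define C where "C = spectral_mat n V (\<lambda>k. complex_of_real (c (J k)))"
  have cC: "C \<in> carrier_mat n n" using cV by (simp add: C_def)
  have hC: "hermitian C" unfolding C_def using cV by (intro hermitian_spectral_mat) auto
  have win_C: "window_space H (I j) \<subseteq> {w \<in> carrier_vec n. C *\<^sub>v w = complex_of_real (c j) \<cdot>\<^sub>v w}" if j: "j < K" for j
  proof (rule window_space_subset_eigenspace[OF cC H(1)])
    fix w E assume E: "E \<in> I j" and ev: "eigenvector H w (complex_of_real E)"
    show "C *\<^sub>v w = complex_of_real (c j) \<cdot>\<^sub>v w"
      unfolding C_def
    proof (rule spectral_mat_eigenvector[OF V])
      show "w \<in> carrier_vec n" "spectral_mat n V (\<lambda>k. complex_of_real (d k)) *\<^sub>v w = complex_of_real E \<cdot>\<^sub>v w"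
        using ev H by (auto simp: eigenvector_def Hs)
      \<comment> \<open>Disjointness makes the window of an energy unique even at a shared endpoint,
        so \<open>J k\<close> is the window j at hand.\<close>
      show "complex_of_real (c (J k)) = complex_of_real (c j)" if "k < n" "d k = E" for k
        using disj[of "J k" j E] J[of k] that j E by simp
    qed
  qed
  have col_win: "col V k \<in> window_space H (I (J k))" if "k < n" for k
    using eigenvector_in_window_space[OF H(1) _ col_ev[OF that]] J[OF that] by blast
  have Ucol: "U *\<^sub>v col V k \<in> window_space H (I (J k))" if k: "k < n" for k
    using u[of "J k"] Uu[OF _ col_win[OF k]] col_win[OF k] J[OF k]
    by (auto simp: unitary_on_def bij_betw_def)
  have CU: "C *\<^sub>v (U *\<^sub>v col V k) = complex_of_real (c (J k)) \<cdot>\<^sub>v (U *\<^sub>v col V k)" if "k < n" for k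
    using win_C[of "J k"] Ucol[OF that] J[OF that] by auto
  have cUV: "U * V \<in> carrier_mat n n" using cU cV by simp
  have colUV: "col (U * V) k = U *\<^sub>v col V k" if "k < n" for k
    using cU cV that by (intro col_mult2)
  \<comment> \<open>Within a window the map \<open>u\<close> preserves inner products; across
    windows the images are eigenvectors of the Hermitian \<open>C\<close> for different
    centres.\<close>
  have orth: "(U *\<^sub>v col V k) \<bullet>c (U *\<^sub>v col V l) = (if k = l then 1 else 0)" if k: "k < n" and l: "l < n" for k l
  proof (cases "J k = J l")
    case True
    have "(U *\<^sub>v col V k) \<bullet>c (U *\<^sub>v col V l) = u (J k) (col V k) \<bullet>c u (J k) (col V l)"
      using Uu[OF _ col_win[OF k]] Uu[OF _ col_win[OF l]] J k l True by simp
    also have "\<dots> = col V k \<bullet>c col V l"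
      using u[of "J k"] col_win[OF k] col_win[OF l] J[OF k] True by (auto simp: unitary_on_def)
    finally show ?thesis using cscalar_prod_cols_unitary[OF V l k] by auto
  next
    case False
    then have "c (J k) \<noteq> c (J l)" using \<delta> by (simp add: c_def)
    moreover have "col V k \<in> carrier_vec n" "col V l \<in> carrier_vec n" using cV by auto
    ultimately show ?thesis
      using hermitian_eigenspace_orthogonal[OF cC hC _ _ CU[OF k] CU[OF l]] cU False
      by (auto simp: mult_mat_vec_carrier[of _ n n])
  qed
  have uUV: "unitary_mat n (U * V)"
  proof (rule unitary_matI[OF cUV], rule eq_matI)
    fix i j assume "i < dim_row (1\<^sub>m n)" "j < dim_col (1\<^sub>m n)"
    then have ij: "i < n" "j < n" by auto
    have "(mat_adjoint (U * V) * (U * V)) $$ (i, j) = col (U * V) j \<bullet>c col (U * V) i"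
      using cUV ij by (simp add: mat_mult_index[of "mat_adjoint (U * V)" n n _ n] cscalar_prod_sum[of _ n]
          mult.commute del: index_mult_mat)
    then show "(mat_adjoint (U * V) * (U * V)) $$ (i, j) = 1\<^sub>m n $$ (i, j)"
      using ij orth[of j i] by (simp add: colUV)
  qed (use cUV in auto)
  note a = assoc_mult_mat[of _ n n _ n _ n] and [simp] = mult_carrier_mat[of _ n n _ n]
  \<comment> \<open>As \<open>U * V\<close> has orthonormal columns, U is a product of two
    unitaries.\<close>
  have UVV: "U = (U * V) * mat_adjoint V"
    using cU cV V by (simp add: a) (simp add: unitary_mat_def)
  have uU: "unitary_mat n U"
    using unitary_mat_mult[OF uUV unitary_mat_adjoint[OF V]] UVV by simp
  have CUV: "C * (U * V) = (U * V) * mat_diag n (\<lambda>k. complex_of_real (c (J k)))"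
  proof (rule eq_matI)
    fix i j assume "i < dim_row (U * V * mat_diag n (\<lambda>k. complex_of_real (c (J k))))"
      "j < dim_col (U * V * mat_diag n (\<lambda>k. complex_of_real (c (J k))))"
    then have ij: "i < n" "j < n" using cUV by (auto simp: mat_diag_mult_right)
    have "(C * (U * V)) $$ (i, j) = col (C * (U * V)) j $ i"
      using cC cUV ij by auto
    also have "col (C * (U * V)) j = complex_of_real (c (J j)) \<cdot>\<^sub>v col (U * V) j"
      using ij by (simp only: col_mult2[OF cC cUV] colUV CU)
    finally show "(C * (U * V)) $$ (i, j) = (U * V * mat_diag n (\<lambda>k. complex_of_real (c (J k)))) $$ (i, j)"
      unfolding mat_diag_mult_right[OF cUV] using cU cV ij by (simp add: mult.commute)
  qed (use cC cUV in \<open>auto simp: mat_diag_mult_right\<close>)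
  \<comment> \<open>By \<open>CUV\<close> both products equal \<open>U * V\<close> times the
    diagonal matrix of centres times the adjoint of \<open>V\<close>.\<close>
  have "C * U = C * (U * V) * mat_adjoint V"
    using cC cUV cV UVV by (metis assoc_mult_mat mat_adjoint_carrier)
  also have "\<dots> = U * C"
    using cU cV unfolding CUV by (simp add: C_def spectral_mat_def a)
  finally have comm: "C * U = U * C" .
  have UCU: "U * C * mat_adjoint U = C"
  proof -
    have "U * C * mat_adjoint U = C * (U * mat_adjoint U)"
      using cC cU by (simp add: comm[symmetric] a)
    then show ?thesis using uU cC by (simp add: unitary_mat_def)
  qed
  define G where "G = spectral_mat n V (\<lambda>k. complex_of_real (d k - c (J k)))"
  have cG: "G \<in> carrier_mat n n" using cV by (simp add: G_def)
  have G: "G = H - C" using spectral_mat_minus[OF cV] by (simp add: G_def Hs C_def)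
  have G_le: "vec_norm2 (G *\<^sub>v w) \<le> \<delta> / 2 * vec_norm2 w" if "w \<in> carrier_vec n" for w
    unfolding G_def
  proof (rule vec_norm2_spectral_mat_le[OF V that])
    fix k assume "k < n"
    then have "d k \<in> {E0 + real (J k) * \<delta> .. E0 + real (J k + 1) * \<delta>}" using J I by blast
    then have "\<bar>d k - c (J k)\<bar> \<le> \<delta> / 2" by (auto simp: c_def abs_le_iff field_simps)
    then show "cmod (complex_of_real (d k - c (J k))) \<le> \<delta> / 2" by (simp only: norm_of_real)
  qed (use \<delta> in simp)
  have "conj_by U G = conj_by U H - C"
    using H cC cU UCU unfolding conj_by_def G
    by (simp add: mult_minus_distrib_mat[of _ n n _ n] minus_mult_distrib_mat[of _ n n _ _ n])
  moreover have "conj_by U H \<in> carrier_mat n n" using cU H by (simp add: conj_by_def)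
  \<comment> \<open>Conjugation by U fixes \<open>C\<close>, so \<open>C\<close> cancels from the
    difference.\<close>
  ultimately have "H - conj_by U H = G - conj_by U G"
    using H cC by (intro eq_matI) (auto simp: G)
  then have "(H - conj_by U H) *\<^sub>v v = G *\<^sub>v v - U *\<^sub>v (G *\<^sub>v (mat_adjoint U *\<^sub>v v))"
    using cG cU v by (simp add: conj_by_def minus_mult_distrib_mat_vec[of _ n n]
        assoc_mult_mat_vec[of _ n n _ n] mult_mat_vec_carrier[of _ n n])
  moreover have "vec_norm2 (G *\<^sub>v v - U *\<^sub>v (G *\<^sub>v (mat_adjoint U *\<^sub>v v)))
      \<le> vec_norm2 (G *\<^sub>v v) + vec_norm2 (G *\<^sub>v (mat_adjoint U *\<^sub>v v))"
    using vec_norm2_minus_le[of "G *\<^sub>v v" n "U *\<^sub>v (G *\<^sub>v (mat_adjoint U *\<^sub>v v))"] cG cU v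
    by (simp add: vec_norm2_unitary[OF uU] mult_mat_vec_carrier[of _ n n])
  moreover have "vec_norm2 (G *\<^sub>v (mat_adjoint U *\<^sub>v v)) \<le> \<delta> / 2 * vec_norm2 v"
    using G_le[of "mat_adjoint U *\<^sub>v v"] vec_norm2_unitary[OF unitary_mat_adjoint[OF uU] v] cU v
    by (simp add: mult_mat_vec_carrier[of _ n n])
  ultimately show ?thesis using G_le[OF v] by simp
qed

section \<open>The main estimate\<close>

lemma local_hamiltonian_hermitian:
  assumes "local_hamiltonian d D k L H"
  shows "H \<in> carrier_mat (d ^ (L ^ D)) (d ^ (L ^ D))" "hermitian H"
proof -
  define n where "n = d ^ (L ^ D)"
  obtain h where h: "\<And>i. i < L ^ D \<Longrightarrow> h i \<in> carrier_mat n n \<and> hermitian (h i)"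
    and H: "H = mat n n (\<lambda>ab. \<Sum>i<L ^ D. h i $$ ab)"
    using assms by (auto simp: local_hamiltonian_def Let_def n_def)
  show *: "H \<in> carrier_mat (d ^ (L ^ D)) (d ^ (L ^ D))" by (simp add: H n_def)
  show "hermitian H"
  proof (rule hermitianI[OF *], rule eq_matI)
    fix a b assume "a < dim_row H" "b < dim_col H"
    then have ab: "a < n" "b < n" by (simp_all add: H)
    have "cnj (h i $$ (b, a)) = h i $$ (a, b)" if "i < L ^ D" for i
      using mat_adjoint_index[of a "h i" b] hermitian_adjoint[of "h i"] h[OF that] ab by auto
    then show "mat_adjoint H $$ (a, b) = H $$ (a, b)" using ab by (simp add: H)
  qed (auto simp: H)
qed

lemma hermitian_conj_by:
  assumes "H \<in> carrier_mat n n" "hermitian H" "U \<in> carrier_mat n n"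
  shows "hermitian (conj_by U H)"
  using assms hermitian_adjoint[OF assms(2)]
  by (intro hermitianI[of _ n])
    (simp_all add: conj_by_def mat_adjoint_mult[of _ n n _ n] assoc_mult_mat[of _ n n _ n _ n] mult_carrier_mat[of _ n n _ n])

lemma op_norm_le:
  assumes "A \<in> carrier_mat m n" "c \<ge> 0"
    and "\<And>v. v \<in> carrier_vec n \<Longrightarrow> vec_norm2 (A *\<^sub>v v) \<le> c * vec_norm2 v"
  shows "op_norm A \<le> c"
  unfolding op_norm_def
proof (rule cSup_least)
  \<comment> \<open>The zero vector shows that the set under the supremum is nonempty.\<close>
  have "vec_norm2 (0\<^sub>v n) \<le> 1" by (simp add: vec_norm2_def)
  then show "{vec_norm2 (A *\<^sub>v v) |v. v \<in> carrier_vec (dim_col A) \<and> vec_norm2 v \<le> 1} \<noteq> {}"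
    using assms(1) by (auto intro!: exI[of _ "0\<^sub>v n"])
next
  fix x assume "x \<in> {vec_norm2 (A *\<^sub>v v) |v. v \<in> carrier_vec (dim_col A) \<and> vec_norm2 v \<le> 1}"
  then obtain v where "x = vec_norm2 (A *\<^sub>v v)" "v \<in> carrier_vec n" "vec_norm2 v \<le> 1"
    using assms(1) by auto
  then show "x \<le> c" using assms(3)[of v] mult_left_mono[of "vec_norm2 v" 1 c] assms(2) by simp
qed

text \<open>The asymptotic relation bounds f only from some index on. The ratios at the finitely
  many earlier indices are added to the constant, which makes the bound hold everywhere.\<close>

lemma bigtheta_uniform_bound:
  fixes f g :: "nat \<Rightarrow> real"
  assumes "f \<in> \<Theta>(g)" "\<And>n. g n > 0"
  shows "\<exists>C>0. \<forall>n. f n \<le> C * g n"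
proof -
  obtain c where c: "c > 0" "eventually (\<lambda>n. norm (f n) \<le> c * norm (g n)) sequentially"
    using bigthetaD1[OF assms(1)] by (rule landau_o.bigE)
  then obtain N where N: "\<And>n. n \<ge> N \<Longrightarrow> \<bar>f n\<bar> \<le> c * \<bar>g n\<bar>"
    by (auto simp: eventually_sequentially)
  define C where "C = c + (\<Sum>n<N. \<bar>f n\<bar> / g n)"
  have S: "0 \<le> (\<Sum>n<N. \<bar>f n\<bar> / g n)" using assms(2) by (intro sum_nonneg) (simp add: less_imp_le)
  have "f n \<le> C * g n" for n
  proof (cases "n \<ge> N")
    case True
    then have "f n \<le> c * g n" using N[of n] assms(2)[of n] by simp
    also have "\<dots> \<le> C * g n" using S assms(2)[of n] by (intro mult_right_mono) (auto simp: C_def)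
    finally show ?thesis .
  next
    case False
    have "\<bar>f n\<bar> / g n \<le> (\<Sum>n<N. \<bar>f n\<bar> / g n)"
      using False assms(2) by (intro member_le_sum) (auto simp: less_imp_le)
    then have "\<bar>f n\<bar> / g n \<le> C" using c by (simp add: C_def)
    then show ?thesis using assms(2)[of n] by (simp add: pos_divide_le_eq)
  qed
  moreover have "C > 0" using S c by (simp add: C_def)
  ultimately show ?thesis by blast
qed

text \<open>The O-constant appears as a C chosen once for the family, before n, U, the state and the
  time, which expresses its uniformity in them.\<close>

theorem mainTheorem5:
  fixes d D k :: nat
  assumes "d \<ge> 1" and "D \<ge> 1"
  shows
    "(\<forall>(L::nat) (\<delta>::real) H K I U.
        L \<ge> 1 \<and> \<delta> > 0 \<and> local_hamiltonian d D k L H \<and> nondegenerate H \<and>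
        energy_windows H \<delta> K I \<and> U \<in> ensemble H K I \<longrightarrow>
        op_norm (H - conj_by U H) \<le> \<delta>)
     \<and>
     (\<forall>(\<alpha>::real) (\<kappa>::real) (L :: nat \<Rightarrow> nat) (\<delta> :: nat \<Rightarrow> real)
        (H :: nat \<Rightarrow> complex mat) (K :: nat \<Rightarrow> nat) (I :: nat \<Rightarrow> nat \<Rightarrow> real set).
        0 \<le> \<alpha> \<and> \<alpha> < 1 \<and> 0 \<le> \<kappa> \<and>
        filterlim L at_top sequentially \<and>
        (\<forall>n. L n \<ge> 1 \<and> \<delta> n > 0 \<and> local_hamiltonian d D k (L n) (H n) \<and> nondegenerate (H n) \<and>
             energy_windows (H n) (\<delta> n) (K n) (I n)) \<and>
        \<delta> \<in> \<Theta>(\<lambda>n. real (L n ^ D) powr ((1 - \<alpha>) / (real D + 1) - \<kappa>)) \<longrightarrow>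
        (\<exists>C>0. \<forall>n. \<forall>U \<in> ensemble (H n) (K n) (I n). \<forall>\<rho> (t::real).
           density_operator (d ^ (L n ^ D)) \<rho> \<and> t \<ge> 0 \<longrightarrow>
           trace_norm (evolve (H n) t \<rho> - evolve (conj_by U (H n)) t \<rho>)
             \<le> 2 * t * (C * real (L n ^ D) powr ((1 - \<alpha>) / (real D + 1) - \<kappa>))))"
proof (rule conjI; intro allI impI; elim conjE)
  fix L :: nat and \<delta> :: real and H K I U
  assume \<delta>: "\<delta> > 0" and H: "local_hamiltonian d D k L H" and win: "energy_windows H \<delta> K I"
    and U: "U \<in> ensemble H K I"
  note h = local_hamiltonian_hermitian[OF H]
  have "H - conj_by U H \<in> carrier_mat (d ^ (L ^ D)) (d ^ (L ^ D))"
    using h U by (auto simp: ensemble_def conj_by_def)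
  then show "op_norm (H - conj_by U H) \<le> \<delta>"
    using ensemble_vec_norm2_diff_le[OF h \<delta> win U] \<delta> by (intro op_norm_le) auto
next
  fix \<alpha> \<kappa> :: real and L :: "nat \<Rightarrow> nat" and \<delta> :: "nat \<Rightarrow> real" and H :: "nat \<Rightarrow> complex mat"
    and K :: "nat \<Rightarrow> nat" and I :: "nat \<Rightarrow> nat \<Rightarrow> real set"
  let ?g = "\<lambda>n. real (L n ^ D) powr ((1 - \<alpha>) / (real D + 1) - \<kappa>)"
  assume sys: "\<forall>n. L n \<ge> 1 \<and> \<delta> n > 0 \<and> local_hamiltonian d D k (L n) (H n) \<and> nondegenerate (H n) \<and>
             energy_windows (H n) (\<delta> n) (K n) (I n)"
    and \<Theta>: "\<delta> \<in> \<Theta>(?g)"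
  \<comment> \<open>From \<open>L n \<ge> 1\<close> the base of \<open>powr\<close> is nonzero;
    positivity permits the division by \<open>?g n\<close> in the uniform bound.\<close>
  have "?g n > 0" for n using sys[rule_format, of n] by simp
  then obtain C where C: "C > 0" "\<And>n. \<delta> n \<le> C * ?g n"
    using bigtheta_uniform_bound[OF \<Theta>] by blast
  show "\<exists>C>0. \<forall>n. \<forall>U \<in> ensemble (H n) (K n) (I n). \<forall>\<rho> (t::real).
           density_operator (d ^ (L n ^ D)) \<rho> \<and> t \<ge> 0 \<longrightarrow>
           trace_norm (evolve (H n) t \<rho> - evolve (conj_by U (H n)) t \<rho>) \<le> 2 * t * (C * ?g n)"
  proof (intro exI[of _ C] conjI allI ballI impI; (elim conjE)?)
    fix n U \<rho> and t :: real
    assume U: "U \<in> ensemble (H n) (K n) (I n)" and \<rho>: "density_operator (d ^ (L n ^ D)) \<rho>" and t: "t \<ge> 0"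
    have \<delta>: "\<delta> n > 0" and win: "energy_windows (H n) (\<delta> n) (K n) (I n)"
      and h: "H n \<in> carrier_mat (d ^ (L n ^ D)) (d ^ (L n ^ D))" "hermitian (H n)"
      using sys[rule_format, of n] local_hamiltonian_hermitian by auto
    have cU: "U \<in> carrier_mat (d ^ (L n ^ D)) (d ^ (L n ^ D))" using U h by (auto simp: ensemble_def)
    have "trace_norm (evolve (H n) t \<rho> - evolve (conj_by U (H n)) t \<rho>) \<le> 2 * t * \<delta> n"
      using h cU by (intro trace_norm_evolve_diff_le[OF h _ hermitian_conj_by[OF h cU] _ \<rho> t]
          ensemble_vec_norm2_diff_le[OF h \<delta> win U]) (auto simp: conj_by_def)
    also have "\<dots> \<le> 2 * t * (C * ?g n)" using C(2)[of n] t by (intro mult_left_mono) auto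
    finally show "trace_norm (evolve (H n) t \<rho> - evolve (conj_by U (H n)) t \<rho>) \<le> 2 * t * (C * ?g n)" .
  qed (rule C(1))
qed

end
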